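(* Let $N\ge 0$ be an integer, let $$M_N=\Big\{\mu_N(x_\theta)=\frac{c_0}{2}+\sum_{n=1}^N\big(c_n\cos(n\theta)+d_n\sin(n\theta)\big):c_n,d_n\in\mathbb{R}\Big\}$$ be the space of trigonometric polynomials of degree at most $N$ on $\Gamma$, and let $V_{h,S}$, $V_{h,R}$ be standard $H^1$-conforming finite element spaces on $\Omega_S$, $\Omega_R$. Suppose that for every rotation angle $\alpha\in\mathbb{R}$ the harmonic mortar problem of finding $(a_{h,S},a_{h,R},\lambda_N)\in V_{h,S}\times V_{h,R}\times M_N$ with $$(\nu_S\nabla a_{h,S},\nabla v_{h,S})_{\Omega_S}+\langle\lambda_N,v_{h,S}\rangle_\Gamma=(j_e,v_{h,S})_{\Omega_S},$$ $$(\nu_R\nabla a_{h,R},\nabla v_{h,R})_{\Omega_R}-\langle\lambda_N,v_{h,R}\circ\rho_{-\alpha}\rangle_\Gamma=-(M^\perp,\nabla v_{h,R})_{\Omega_R},$$ $$\langle a_{h,S}-a_{h,R}\circ\rho_{-\alpha},\mu_N\rangle_\Gamma=0$$ for all $v_{h,S}\in V_{h,S}$, $v_{h,R}\in V_{h,R}$, $\mu_N\in M_N$ is uniquely solvable. Then the discrete torque $$T_{h,N}(\alpha)=\Big\langle\lambda_N,\Big(\frac{d}{d\theta}a_{h,R}\Big)\circ\rho_{-\alpha}\Big\rangle_\Gamma$$ is an infinitely differentiable function of $\alpha$.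
   Context: Geometry: $\Omega_S,\Omega_R\subset\mathbb{R}^2$ are bounded, sufficiently regular (e.g. Lipschitz) domains (stator and rotor); $\Omega_S$ completely encloses $\Omega_R$, and the common interface $\Gamma=\partial\Omega_S\cap\partial\Omega_R=\partial\Omega_R$ is the circle of radius $r_\Gamma>0$ centered at the origin. $\Sigma=\partial\Omega_S\setminus\Gamma$ is the outer boundary. Points of $\Gamma$ are written $x_\theta=(r_\Gamma\cos\theta,r_\Gamma\sin\theta)$. $\rho_\alpha$ is the rotation of the plane by the angle $\alpha$ about the origin, so $\rho_{-\alpha}(x_\theta)=x_{\theta-\alpha}$. For the trace on $\Gamma$ of a function $u$ on $\Omega_R$, $\frac{d}{d\theta}u$ is the derivative of $\theta\mapsto u(x_\theta)$. Data: $\nu_S,\nu_R$ are scalar coefficient functions on $\Omega_S,\Omega_R$, uniformly positive and bounded from above; $j_e\in L^2(\Omega_S)$ and the rotated magnetization $M^\perp\in L^2(\Omega_R)^2$. All these data are independent of $\alpha$. Spaces: $V_{h,S}\subset H^1_\Sigma(\Omega_S)=\{v\in H^1(\Omega_S):v=0\text{ on }\Sigma\}$ and $V_{h,R}\subset H^1(\Omega_R)$ are finite-dimensional real subspaces independent of $\alpha$, consisting of continuous piecewise smooth functions over meshes of $\Omega_S$ and $\Omega_R$ (no conformity of the meshes across $\Gamma$ is required); in particular traces on $\Gamma$ of functions in $V_{h,R}$ lie in $H^1(\Gamma)$. $(\cdot,\cdot)_\Omega$ is the $L^2(\Omega)$ inner product and $\langle\cdot,\cdot\rangle_\Gamma$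 is the $L^2(\Gamma)$ inner product with respect to arc length $r_\Gamma\,d\theta$. *)

theory Defs
  imports "HOL-Analysis.Analysis"
begin

section \<open>Domains and meshes\<close>

text \<open>Near each boundary point, in a suitable orthonormal frame \<open>Q\<close>, the set is
  the part of a rectangle lying strictly above a Lipschitz graph.\<close>

definition lipschitz_domain :: "(real^2) set \<Rightarrow> bool" where
  "lipschitz_domain \<Omega> \<longleftrightarrow> open \<Omega> \<and> connected \<Omega> \<and> \<Omega> \<noteq> {} \<and>
     (\<forall>p\<in>frontier \<Omega>. \<exists>(Q :: real^2 \<Rightarrow> real^2) (\<phi> :: real \<Rightarrow> real) L \<delta> h.
        orthogonal_transformation Q \<and> L-lipschitz_on UNIV \<phi> \<and> \<delta> > 0 \<and> h > 0 \<and>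
        (\<forall>s t. \<bar>s\<bar> < \<delta> \<and> \<bar>t\<bar> < h \<longrightarrow> (p + Q (vector [s, t]) \<in> \<Omega> \<longleftrightarrow> \<phi> s < t)))"

text \<open>Cells may be curved, hanging nodes are allowed, and nothing is required of two
  meshes relative to each other.\<close>

definition mesh :: "(real^2) set \<Rightarrow> (real^2) set set \<Rightarrow> bool" where
  "mesh \<Omega> \<T> \<longleftrightarrow> finite \<T> \<and> \<Union>\<T> = closure \<Omega> \<and>
     (\<forall>K\<in>\<T>. compact K \<and> K = closure (interior K)) \<and>
     (\<forall>K\<in>\<T>. \<forall>K'\<in>\<T>. K \<noteq> K' \<longrightarrow> interior K \<inter> interior K' = {})"


section \<open>Smooth functions and the Sobolev space of order one\<close>

definition partial_deriv :: "2 \<Rightarrow> (real^2 \<Rightarrow> real) \<Rightarrow> real^2 \<Rightarrow> real" where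
  "partial_deriv i f x = frechet_derivative f (at x) (axis i 1)"

definition grad :: "(real^2 \<Rightarrow> real) \<Rightarrow> real^2 \<Rightarrow> real^2" where
  "grad f x = (\<chi> i. partial_deriv i f x)"

primrec Ck_on :: "nat \<Rightarrow> (real^2) set \<Rightarrow> (real^2 \<Rightarrow> real) \<Rightarrow> bool" where
  "Ck_on 0 U f \<longleftrightarrow> continuous_on U f"
| "Ck_on (Suc k) U f \<longleftrightarrow> f differentiable_on U \<and> (\<forall>i. Ck_on k U (partial_deriv i f))"

definition smooth_on :: "(real^2) set \<Rightarrow> (real^2 \<Rightarrow> real) \<Rightarrow> bool" where
  "smooth_on U f \<longleftrightarrow> open U \<and> (\<forall>k. Ck_on k U f)"

definition test_function :: "(real^2) set \<Rightarrow> (real^2 \<Rightarrow> real) \<Rightarrow> bool" where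
  "test_function \<Omega> \<phi> \<longleftrightarrow> smooth_on UNIV \<phi> \<and>
     compact (closure {x. \<phi> x \<noteq> 0}) \<and> closure {x. \<phi> x \<noteq> 0} \<subseteq> \<Omega>"

definition L2 :: "(real^2) set \<Rightarrow> (real^2 \<Rightarrow> 'b::euclidean_space) set" where
  "L2 \<Omega> = {f. f \<in> borel_measurable (lebesgue_on \<Omega>) \<and>
               integrable (lebesgue_on \<Omega>) (\<lambda>x. (norm (f x))\<^sup>2)}"

definition L2_inner ::
    "(real^2) set \<Rightarrow> (real^2 \<Rightarrow> 'b::euclidean_space) \<Rightarrow> (real^2 \<Rightarrow> 'b) \<Rightarrow> real" where
  "L2_inner \<Omega> f g = (LINT x|lebesgue_on \<Omega>. f x \<bullet> g x)"

definition has_weak_grad ::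
    "(real^2) set \<Rightarrow> (real^2 \<Rightarrow> real) \<Rightarrow> (real^2 \<Rightarrow> real^2) \<Rightarrow> bool" where
  "has_weak_grad \<Omega> v G \<longleftrightarrow> v \<in> L2 \<Omega> \<and> G \<in> L2 \<Omega> \<and>
     (\<forall>\<phi>. test_function \<Omega> \<phi> \<longrightarrow>
        (LINT x|lebesgue_on \<Omega>. v x *\<^sub>R grad \<phi> x) = - (LINT x|lebesgue_on \<Omega>. \<phi> x *\<^sub>R G x))"

definition H1 :: "(real^2) set \<Rightarrow> (real^2 \<Rightarrow> real) set" where
  "H1 \<Omega> = {v. \<exists>G. has_weak_grad \<Omega> v G}"

text \<open>A representative; it is determined up to a null set of an open \<open>\<Omega>\<close>.\<close>

definition weak_grad :: "(real^2) set \<Rightarrow> (real^2 \<Rightarrow> real) \<Rightarrow> real^2 \<Rightarrow> real^2" where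
  "weak_grad \<Omega> v = (SOME G. has_weak_grad \<Omega> v G)"

definition coefficient :: "(real^2) set \<Rightarrow> (real^2 \<Rightarrow> real) \<Rightarrow> bool" where
  "coefficient \<Omega> \<nu> \<longleftrightarrow> \<nu> \<in> borel_measurable (lebesgue_on \<Omega>) \<and>
     (\<exists>c C. 0 < c \<and> (AE x in lebesgue_on \<Omega>. c \<le> \<nu> x \<and> \<nu> x \<le> C))"


section \<open>Finite element spaces\<close>

definition finite_dim_space :: "(real^2 \<Rightarrow> real) set \<Rightarrow> bool" where
  "finite_dim_space V \<longleftrightarrow> (\<exists>B. finite B \<and> V = {(\<lambda>x. \<Sum>b\<in>B. c b * b x) | c. True})"

definition piecewise_smooth :: "(real^2) set set \<Rightarrow> (real^2 \<Rightarrow> real) \<Rightarrow> bool" where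
  "piecewise_smooth \<T> v \<longleftrightarrow>
     (\<forall>K\<in>\<T>. \<exists>U f. K \<subseteq> U \<and> smooth_on U f \<and> (\<forall>x\<in>K. v x = f x))"

text \<open>A function on \<open>closure \<Omega>\<close> is represented by its extension by zero, so that
  equality of functions on \<open>closure \<Omega>\<close> is equality in HOL. As the functions are
  continuous on \<open>closure \<Omega>\<close>, their traces are their restrictions to the boundary.\<close>

definition fe_space ::
    "(real^2) set \<Rightarrow> (real^2) set set \<Rightarrow> (real^2 \<Rightarrow> real) set \<Rightarrow> bool" where
  "fe_space \<Omega> \<T> V \<longleftrightarrow> finite_dim_space V \<and> V \<subseteq> H1 \<Omega> \<and>
     (\<forall>v\<in>V. continuous_on (closure \<Omega>) v \<and> piecewise_smooth \<T> v \<and>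
             (\<forall>x. x \<notin> closure \<Omega> \<longrightarrow> v x = 0))"


section \<open>The interface circle\<close>

definition circ_pt :: "real \<Rightarrow> real \<Rightarrow> real^2" where
  "circ_pt r \<theta> = vector [r * cos \<theta>, r * sin \<theta>]"

definition rot :: "real \<Rightarrow> real^2 \<Rightarrow> real^2" where
  "rot \<alpha> x = vector [cos \<alpha> * x$1 - sin \<alpha> * x$2, sin \<alpha> * x$1 + cos \<alpha> * x$2]"

definition circ_inner :: "real \<Rightarrow> (real^2 \<Rightarrow> real) \<Rightarrow> (real^2 \<Rightarrow> real) \<Rightarrow> real" where
  "circ_inner r f g = (LINT \<theta>|lebesgue_on {0..2*pi}. f (circ_pt r \<theta>) * g (circ_pt r \<theta>) * r)"

text \<open>Since \<open>rot t (circ_pt r \<theta>) = circ_pt r (\<theta> + t)\<close>, the value at \<open>circ_pt r \<theta>\<close> is the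
  derivative of \<open>\<lambda>\<theta>. u (circ_pt r \<theta>)\<close> at \<open>\<theta>\<close>. For continuous piecewise smooth \<open>u\<close> this
  derivative exists outside a countable set of angles; elsewhere \<open>deriv\<close> is arbitrary.\<close>

definition ang_deriv :: "(real^2 \<Rightarrow> real) \<Rightarrow> real^2 \<Rightarrow> real" where
  "ang_deriv u x = deriv (\<lambda>t. u (rot t x)) 0"

text \<open>Functions on the circle are also extended by zero.\<close>

definition trig_space :: "real \<Rightarrow> nat \<Rightarrow> (real^2 \<Rightarrow> real) set" where
  "trig_space r N = {\<mu>. (\<exists>c d :: nat \<Rightarrow> real. \<forall>\<theta>. \<mu> (circ_pt r \<theta>) =
        c 0 / 2 + (\<Sum>n=1..N. c n * cos (real n * \<theta>) + d n * sin (real n * \<theta>))) \<and>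
      (\<forall>x. x \<notin> sphere 0 r \<longrightarrow> \<mu> x = 0)}"


section \<open>The harmonic mortar problem and the torque\<close>

definition mortar_solution ::
    "(real^2) set \<Rightarrow> (real^2) set \<Rightarrow> real \<Rightarrow> (real^2 \<Rightarrow> real) \<Rightarrow> (real^2 \<Rightarrow> real) \<Rightarrow>
     (real^2 \<Rightarrow> real) \<Rightarrow> (real^2 \<Rightarrow> real^2) \<Rightarrow>
     (real^2 \<Rightarrow> real) set \<Rightarrow> (real^2 \<Rightarrow> real) set \<Rightarrow> nat \<Rightarrow> real \<Rightarrow>
     (real^2 \<Rightarrow> real) \<times> (real^2 \<Rightarrow> real) \<times> (real^2 \<Rightarrow> real) \<Rightarrow> bool" where
  "mortar_solution \<Omega>S \<Omega>R r \<nu>S \<nu>R je Mperp VS VR N \<alpha> = (\<lambda>(aS, aR, lam).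
     aS \<in> VS \<and> aR \<in> VR \<and> lam \<in> trig_space r N \<and>
     (\<forall>v\<in>VS. L2_inner \<Omega>S (\<lambda>x. \<nu>S x *\<^sub>R weak_grad \<Omega>S aS x) (weak_grad \<Omega>S v)
             + circ_inner r lam v = L2_inner \<Omega>S je v) \<and>
     (\<forall>v\<in>VR. L2_inner \<Omega>R (\<lambda>x. \<nu>R x *\<^sub>R weak_grad \<Omega>R aR x) (weak_grad \<Omega>R v)
             - circ_inner r lam (v \<circ> rot (- \<alpha>)) = - L2_inner \<Omega>R Mperp (weak_grad \<Omega>R v)) \<and>
     (\<forall>\<mu>\<in>trig_space r N. circ_inner r (\<lambda>x. aS x - (aR \<circ> rot (- \<alpha>)) x) \<mu> = 0))"

definition torque ::
    "real \<Rightarrow> real \<Rightarrow> (real^2 \<Rightarrow> real) \<times> (real^2 \<Rightarrow> real) \<times> (real^2 \<Rightarrow> real) \<Rightarrow> real" where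
  "torque r \<alpha> = (\<lambda>(aS, aR, lam). circ_inner r lam (ang_deriv aR \<circ> rot (- \<alpha>)))"

definition infinitely_differentiable :: "(real \<Rightarrow> real) \<Rightarrow> bool" where
  "infinitely_differentiable f \<longleftrightarrow> (\<forall>n x. (deriv ^^ n) f differentiable (at x))"

end

theory Submission
  imports Defs
begin

text \<open>
  Expanding \<open>(aS, aR, lam)\<close> in bases of \<open>VS\<close>, \<open>VR\<close> and the trigonometric polynomials turns the
  mortar problem at angle \<open>\<alpha>\<close> into a square linear system. The angle enters its matrix only
  through the pairings of trigonometric polynomials \<open>e\<close> with rotated traces \<open>w \<circ> rot (- \<alpha>)\<close>.
  Shifting the variable of integration moves the rotation onto \<open>e\<close>, and the addition theorems
  express \<open>e (\<theta> + \<alpha>)\<close> by products of functions of \<open>\<alpha>\<close> and of \<open>\<theta>\<close>; so each pairing is a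
  trigonometric polynomial in \<open>\<alpha>\<close>, however rough \<open>w\<close> is (\<open>smooth_circ_inner_rot\<close>). Unique
  solvability makes the matrix injective for every \<open>\<alpha>\<close>, hence the coefficients of the solution
  are smooth in \<open>\<alpha>\<close> (\<open>linear_system_smooth\<close>). The torque is a finite sum of products of these
  coefficients with pairings of the same kind, where now \<open>w\<close> is the angular derivative of a basis
  function, and is therefore smooth as well.

  Smoothness of the solution needs no determinants: multiplying an injective system by its
  transpose makes it positive definite, and Gaussian elimination on a positive definite system
  divides only by pivots that are positive for all \<open>\<alpha>\<close> simultaneously.

  Two points of the reduction to a linear system need an analytic argument. The first is that the
  bilinear forms really are bilinear: \<open>weak_grad\<close> is a choice of representative, so it is linear
  only almost everywhere, by the fundamental lemma of the calculus of variations
  (\<open>AE_zero_of_test_integrals\<close>). The second is that \<open>ang_deriv\<close> is integrable, and linear almost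
  everywhere, on \<open>VR\<close>. Cells may meet the circle in arbitrary closed sets, but a trace glued from
  finitely many differentiable functions on closed sets can fail to be differentiable only at
  isolated points of an intersection of two of these sets, hence at countably many points
  (\<open>piecewise_differentiable\<close>).
\<close>

section \<open>Smooth functions of one real variable\<close>

text \<open>Unlike the definition of \<open>infinitely_differentiable\<close>, this recursion unfolds one derivative of
  \<open>f\<close> at the front, which makes closure under products and quotients a plain induction on \<open>n\<close>.\<close>

primrec diff_times :: "nat \<Rightarrow> (real \<Rightarrow> real) \<Rightarrow> bool" where
  "diff_times 0 f \<longleftrightarrow> True"
| "diff_times (Suc n) f \<longleftrightarrow> (\<forall>x. f differentiable at x) \<and> diff_times n (deriv f)"

lemma diff_times_iff: "diff_times n f \<longleftrightarrow> (\<forall>m<n. \<forall>x. (deriv ^^ m) f differentiable at x)"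
proof (induction n arbitrary: f)
  case (Suc n)
  then show ?case
    by (simp add: All_less_Suc2 funpow_Suc_right del: funpow.simps(2))
qed simp

lemma infinitely_differentiable_iff: "infinitely_differentiable f \<longleftrightarrow> (\<forall>n. diff_times n f)"
  unfolding infinitely_differentiable_def diff_times_iff by blast

lemma diff_times_SucI:
  assumes "\<And>x. (f has_real_derivative g x) (at x)" "diff_times n g"
  shows "diff_times (Suc n) f"
proof -
  have "deriv f = g" using assms(1) DERIV_imp_deriv by blast
  then show ?thesis using assms by (auto simp: real_differentiable_def)
qed

lemma diff_times_SucD:
  assumes "diff_times (Suc n) f"
  shows "(f has_real_derivative deriv f x) (at x)" "diff_times n (deriv f)"
  using assms by (simp_all add: DERIV_deriv_iff_real_differentiable)

lemma diff_times_Suc_imp: "diff_times (Suc n) f \<Longrightarrow> diff_times n f"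
  by (simp add: diff_times_iff del: diff_times.simps)

lemma diff_times_const: "diff_times n (\<lambda>x. c)"
proof (induction n arbitrary: c)
  case (Suc n)
  show ?case by (rule diff_times_SucI[where g = "\<lambda>x. 0"]) (auto intro: Suc)
qed simp

lemma diff_times_add: "diff_times n f \<Longrightarrow> diff_times n g \<Longrightarrow> diff_times n (\<lambda>x. f x + g x)"
proof (induction n arbitrary: f g)
  case (Suc n)
  show ?case
    by (rule diff_times_SucI[where g = "\<lambda>x. deriv f x + deriv g x"])
      (use Suc diff_times_SucD in \<open>blast intro: DERIV_add\<close>)+
qed simp

lemma diff_times_mult: "diff_times n f \<Longrightarrow> diff_times n g \<Longrightarrow> diff_times n (\<lambda>x. f x * g x)"
proof (induction n arbitrary: f g)
  case (Suc n)
  show ?case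
  proof (rule diff_times_SucI[where g = "\<lambda>x. deriv f x * g x + deriv g x * f x"])
    show "diff_times n (\<lambda>x. deriv f x * g x + deriv g x * f x)"
      by (intro diff_times_add Suc.IH diff_times_SucD(2) Suc.prems diff_times_Suc_imp)
  qed (intro DERIV_mult diff_times_SucD(1)[OF Suc.prems(1)] diff_times_SucD(1)[OF Suc.prems(2)])
qed simp

lemma diff_times_inverse:
  "diff_times n f \<Longrightarrow> (\<And>x. f x \<noteq> 0) \<Longrightarrow> diff_times n (\<lambda>x. inverse (f x))"
proof (induction n)
  case (Suc n)
  have inv: "diff_times n (\<lambda>x. inverse (f x))"
    using Suc diff_times_Suc_imp by blast
  show ?case
  proof (rule diff_times_SucI[where g = "\<lambda>x. (-1) * (inverse (f x) * deriv f x * inverse (f x))"])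
    show "diff_times n (\<lambda>x. (-1) * (inverse (f x) * deriv f x * inverse (f x)))"
      by (intro diff_times_mult inv diff_times_const diff_times_SucD(2) Suc.prems)
    fix x
    show "((\<lambda>x. inverse (f x)) has_real_derivative
        (-1) * (inverse (f x) * deriv f x * inverse (f x))) (at x)"
      using DERIV_inverse'[OF diff_times_SucD(1)[OF Suc.prems(1)] Suc.prems(2), of x] by simp
  qed
qed simp

lemma diff_times_affine:
  "diff_times n f \<Longrightarrow> diff_times n (\<lambda>x. f (a * x + b))"
proof (induction n arbitrary: f)
  case (Suc n)
  show ?case
  proof (rule diff_times_SucI[where g = "\<lambda>x. deriv f (a * x + b) * a"])
    show "diff_times n (\<lambda>x. deriv f (a * x + b) * a)"
      by (intro diff_times_mult diff_times_const Suc.IH diff_times_SucD(2) Suc.prems)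
    fix x
    show "((\<lambda>x. f (a * x + b)) has_real_derivative deriv f (a * x + b) * a) (at x)"
      by (rule DERIV_chain2[OF diff_times_SucD(1)[OF Suc.prems]])
        (auto intro!: derivative_eq_intros)
  qed
qed simp

lemma diff_times_sin_cos: "diff_times n (sin :: real \<Rightarrow> real) \<and> diff_times n (cos :: real \<Rightarrow> real)"
proof (induction n)
  case (Suc n)
  then have "diff_times n (\<lambda>x::real. (-1) * sin x)"
    by (intro diff_times_mult diff_times_const) simp
  then show ?case
    using Suc by (intro conjI diff_times_SucI[of sin cos] diff_times_SucI[of cos "\<lambda>x. (-1) * sin x"])
      (auto intro!: derivative_eq_intros)
qed simp

named_theorems smooth_intros

lemma smooth_const [smooth_intros]: "infinitely_differentiable (\<lambda>x. c)"
  by (simp add: infinitely_differentiable_iff diff_times_const)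

lemma smooth_add [smooth_intros]:
  "infinitely_differentiable f \<Longrightarrow> infinitely_differentiable g \<Longrightarrow>
    infinitely_differentiable (\<lambda>x. f x + g x)"
  by (simp add: infinitely_differentiable_iff diff_times_add)

lemma smooth_mult [smooth_intros]:
  "infinitely_differentiable f \<Longrightarrow> infinitely_differentiable g \<Longrightarrow>
    infinitely_differentiable (\<lambda>x. f x * g x)"
  by (simp add: infinitely_differentiable_iff diff_times_mult)

lemma smooth_minus [smooth_intros]:
  "infinitely_differentiable f \<Longrightarrow> infinitely_differentiable (\<lambda>x. - f x)"
  using smooth_mult[OF smooth_const[of "-1"]] by simp

lemma smooth_diff [smooth_intros]:
  "infinitely_differentiable f \<Longrightarrow> infinitely_differentiable g \<Longrightarrow>
    infinitely_differentiable (\<lambda>x. f x - g x)"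
  using smooth_add[OF _ smooth_minus] by simp

lemma smooth_divide [smooth_intros]:
  "infinitely_differentiable f \<Longrightarrow> infinitely_differentiable g \<Longrightarrow> (\<And>x. g x \<noteq> 0) \<Longrightarrow>
    infinitely_differentiable (\<lambda>x. f x / g x)"
  by (simp add: infinitely_differentiable_iff diff_times_mult diff_times_inverse divide_inverse)

lemma smooth_sum [smooth_intros]:
  "(\<And>i. i \<in> I \<Longrightarrow> infinitely_differentiable (f i)) \<Longrightarrow>
    infinitely_differentiable (\<lambda>x. \<Sum>i\<in>I. f i x)"
  by (induction I rule: infinite_finite_induct) (auto intro: smooth_intros)

lemma smooth_sin_cos [smooth_intros]:
  "infinitely_differentiable (\<lambda>x. sin (a * x))" "infinitely_differentiable (\<lambda>x. cos (a * x))"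
  using diff_times_affine[of _ sin a 0] diff_times_affine[of _ cos a 0] diff_times_sin_cos
  by (auto simp: infinitely_differentiable_iff)

lemma smooth_affine:
  "infinitely_differentiable f \<Longrightarrow> infinitely_differentiable (\<lambda>x. f (a * x + b))"
  by (simp add: infinitely_differentiable_iff diff_times_affine)

lemma smooth_deriv:
  assumes "infinitely_differentiable f"
  shows "(f has_real_derivative deriv f x) (at x)" "infinitely_differentiable (deriv f)"
  using assms diff_times_SucD unfolding infinitely_differentiable_iff by blast+

lemma smooth_continuous_on: "infinitely_differentiable f \<Longrightarrow> continuous_on A f"
  by (meson DERIV_isCont continuous_at_imp_continuous_on smooth_deriv(1))

section \<open>Linear systems with smooth coefficients\<close>

text \<open>Gaussian elimination, one unknown at a time: the Schur complement of a positive definite matrix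
  is positive definite, since its quadratic form at \<open>y\<close> is that of \<open>G\<close> at the extension of \<open>y\<close>
  annihilating row \<open>k\<close>. The pivots are positive for every \<open>\<alpha>\<close>, so one elimination order serves
  all \<open>\<alpha>\<close> and no argument local in \<open>\<alpha>\<close> is needed.\<close>

lemma positive_definite_system_smooth:
  fixes G :: "'i \<Rightarrow> 'i \<Rightarrow> real \<Rightarrow> real"
  assumes "finite I"
    and "\<And>i j. i \<in> I \<Longrightarrow> j \<in> I \<Longrightarrow> infinitely_differentiable (G i j)"
    and "\<And>i. i \<in> I \<Longrightarrow> infinitely_differentiable (g i)"
    and "\<And>\<alpha> i. i \<in> I \<Longrightarrow> (\<Sum>j\<in>I. G i j \<alpha> * x j \<alpha>) = g i \<alpha>"
    and "\<And>\<alpha> y. (\<exists>i\<in>I. y i \<noteq> 0) \<Longrightarrow> (\<Sum>i\<in>I. y i * (\<Sum>j\<in>I. G i j \<alpha> * y j)) > 0"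
  shows "\<forall>i\<in>I. infinitely_differentiable (x i)"
  using assms
proof (induction I arbitrary: G g rule: finite_induct)
  case (insert k I)
  have pivot: "G k k \<alpha> > 0" for \<alpha>
  proof -
    have "(\<Sum>i\<in>insert k I. (if i = k then 1 else 0) *
        (\<Sum>j\<in>insert k I. G i j \<alpha> * (if j = k then 1 else 0))) = G k k \<alpha>"
      using insert.hyps by (simp add: if_distrib if_distribR sum.delta cong: if_cong)
    then show ?thesis
      using insert.prems(4)[of "\<lambda>i. if i = k then 1 else 0" \<alpha>] by simp
  qed
  then have pivot0: "G k k \<alpha> \<noteq> 0" for \<alpha>
    by (metis less_irrefl)
  have row_k: "x k \<alpha> = (g k \<alpha> - (\<Sum>j\<in>I. G k j \<alpha> * x j \<alpha>)) / G k k \<alpha>" for \<alpha>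
    using insert.prems(3)[of k \<alpha>] insert.hyps pivot0[of \<alpha>] by (simp add: field_simps)
  \<comment> \<open>Schur complement and right-hand side after elimination of the unknown \<open>k\<close>\<close>
  define S where "S = (\<lambda>i j \<alpha>. G i j \<alpha> - G i k \<alpha> * G k j \<alpha> / G k k \<alpha>)"
  define s where "s = (\<lambda>i \<alpha>. g i \<alpha> - G i k \<alpha> * g k \<alpha> / G k k \<alpha>)"
  have schur: "(\<Sum>j\<in>I. S i j \<alpha> * y j) =
      (\<Sum>j\<in>I. G i j \<alpha> * y j) - G i k \<alpha> * (\<Sum>j\<in>I. G k j \<alpha> * y j) / G k k \<alpha>" for i \<alpha> y
    unfolding S_def
    by (simp add: left_diff_distrib sum_subtractf sum_distrib_left sum_divide_distrib mult.assoc)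
  have "\<forall>i\<in>I. infinitely_differentiable (x i)"
  proof (rule insert.IH[where G = S and g = s])
    fix i j assume "i \<in> I" "j \<in> I"
    then show "infinitely_differentiable (S i j)"
      unfolding S_def using insert.prems(1) pivot0 by (intro smooth_intros) auto
  next
    fix i assume "i \<in> I"
    then show "infinitely_differentiable (s i)"
      unfolding s_def using insert.prems(1,2) pivot0 by (intro smooth_intros) auto
  next
    fix \<alpha> i assume i: "i \<in> I"
    have "(\<Sum>j\<in>I. G i j \<alpha> * x j \<alpha>) = g i \<alpha> - G i k \<alpha> * x k \<alpha>"
      using insert.prems(3)[of i \<alpha>] insert.hyps i by simp
    then show "(\<Sum>j\<in>I. S i j \<alpha> * x j \<alpha>) = s i \<alpha>"
      unfolding schur s_def row_k by (simp add: diff_divide_distrib right_diff_distrib)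
  next
    fix \<alpha> and y :: "'i \<Rightarrow> real" assume y: "\<exists>i\<in>I. y i \<noteq> 0"
    \<comment> \<open>chosen such that row \<open>k\<close> of \<open>G z\<close> vanishes\<close>
    define z where "z = y(k := - (\<Sum>j\<in>I. G k j \<alpha> * y j) / G k k \<alpha>)"
    have zI: "(\<Sum>j\<in>I. G i j \<alpha> * z j) = (\<Sum>j\<in>I. G i j \<alpha> * y j)" for i
      using insert.hyps by (intro sum.cong) (auto simp: z_def)
    have Gz: "(\<Sum>j\<in>insert k I. G i j \<alpha> * z j) = (\<Sum>j\<in>I. S i j \<alpha> * y j)" for i
      using insert.hyps unfolding schur by (simp add: zI) (simp add: z_def)
    have "(\<Sum>j\<in>I. S k j \<alpha> * y j) = 0"
      unfolding schur using pivot0 by simp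
    then have "(\<Sum>i\<in>insert k I. z i * (\<Sum>j\<in>insert k I. G i j \<alpha> * z j)) =
        (\<Sum>i\<in>I. z i * (\<Sum>j\<in>I. S i j \<alpha> * y j))"
      unfolding Gz using insert.hyps by simp
    also have "\<dots> = (\<Sum>i\<in>I. y i * (\<Sum>j\<in>I. S i j \<alpha> * y j))"
      using insert.hyps by (intro sum.cong) (auto simp: z_def)
    finally have eq: "(\<Sum>i\<in>insert k I. z i * (\<Sum>j\<in>insert k I. G i j \<alpha> * z j)) =
        (\<Sum>i\<in>I. y i * (\<Sum>j\<in>I. S i j \<alpha> * y j))" .
    have "\<exists>i\<in>insert k I. z i \<noteq> 0"
      using y insert.hyps(2) by (metis fun_upd_other insertCI z_def)
    then show "(\<Sum>i\<in>I. y i * (\<Sum>j\<in>I. S i j \<alpha> * y j)) > 0"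
      using insert.prems(4)[of z \<alpha>] eq by simp
  qed
  moreover have "infinitely_differentiable (x k)"
  proof -
    let ?R = "\<lambda>\<alpha>. (g k \<alpha> - (\<Sum>j\<in>I. G k j \<alpha> * x j \<alpha>)) / G k k \<alpha>"
    have "infinitely_differentiable ?R"
      using insert.prems(1,2) calculation pivot0 by (intro smooth_intros) auto
    moreover have "x k = ?R" using row_k by (rule ext)
    ultimately show ?thesis by (rule ssubst[rotated])
  qed
  ultimately show ?case by simp
qed simp

text \<open>The normal equations turn injectivity into positive definiteness, since their quadratic form at
  \<open>y\<close> is the squared norm of \<open>A y\<close>.\<close>

lemma linear_system_smooth:
  fixes A :: "'i \<Rightarrow> 'i \<Rightarrow> real \<Rightarrow> real"
  assumes I: "finite I"
    and A: "\<And>i j. i \<in> I \<Longrightarrow> j \<in> I \<Longrightarrow> infinitely_differentiable (A i j)"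
    and b: "\<And>i. i \<in> I \<Longrightarrow> infinitely_differentiable (b i)"
    and x: "\<And>\<alpha> i. i \<in> I \<Longrightarrow> (\<Sum>j\<in>I. A i j \<alpha> * x j \<alpha>) = b i \<alpha>"
    and inj: "\<And>\<alpha> y i. (\<And>i. i \<in> I \<Longrightarrow> (\<Sum>j\<in>I. A i j \<alpha> * y j) = 0) \<Longrightarrow> i \<in> I \<Longrightarrow> y i = 0"
    and "i \<in> I"
  shows "infinitely_differentiable (x i)"
proof -
  define G where "G = (\<lambda>i j \<alpha>. \<Sum>m\<in>I. A m i \<alpha> * A m j \<alpha>)"
  define g where "g = (\<lambda>i \<alpha>. \<Sum>m\<in>I. A m i \<alpha> * b m \<alpha>)"
  have G: "(\<Sum>j\<in>I. G i j \<alpha> * y j) = (\<Sum>m\<in>I. A m i \<alpha> * (\<Sum>j\<in>I. A m j \<alpha> * y j))" for i \<alpha> y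
    unfolding G_def sum_distrib_left sum_distrib_right
    by (subst sum.swap) (simp add: mult.assoc)
  have "\<forall>i\<in>I. infinitely_differentiable (x i)"
  proof (rule positive_definite_system_smooth[OF I, of G g])
    fix \<alpha> and y :: "'i \<Rightarrow> real" assume y: "\<exists>i\<in>I. y i \<noteq> 0"
    have "(\<Sum>i\<in>I. y i * (\<Sum>j\<in>I. G i j \<alpha> * y j)) = (\<Sum>m\<in>I. (\<Sum>j\<in>I. A m j \<alpha> * y j)\<^sup>2)"
      unfolding G sum_distrib_left[where r = "y _"] power2_eq_square
      by (subst sum.swap) (simp add: sum_distrib_left sum_distrib_right mult_ac)
    moreover have "\<exists>m\<in>I. (\<Sum>j\<in>I. A m j \<alpha> * y j)\<^sup>2 > 0"
      using inj[of \<alpha> y] y by (metis zero_less_power2)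
    ultimately show "(\<Sum>i\<in>I. y i * (\<Sum>j\<in>I. G i j \<alpha> * y j)) > 0"
      using I by (metis (no_types, lifting) sum_pos2 zero_le_power2)
  next
    show "(\<Sum>j\<in>I. G i j \<alpha> * x j \<alpha>) = g i \<alpha>" for i \<alpha>
      unfolding G g_def by (simp add: x)
  qed (auto simp: g_def G_def intro!: smooth_intros A b)
  then show ?thesis using assms by blast
qed

text \<open>The block system of the mortar problem: \<open>KS\<close> and \<open>KR\<close> are the stiffness matrices, \<open>C\<close> and \<open>E\<close>
  the couplings of the multiplier with the stator and with the rotated rotor.\<close>

lemma saddle_point_coefficients_smooth:
  fixes KS :: "'a \<Rightarrow> 'a \<Rightarrow> real" and KR :: "'b \<Rightarrow> 'b \<Rightarrow> real"
    and C :: "'c \<Rightarrow> 'a \<Rightarrow> real" and E :: "'c \<Rightarrow> 'b \<Rightarrow> real \<Rightarrow> real"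
  assumes fin: "finite IS" "finite IR" "finite IL"
    and E: "\<And>k j. k \<in> IL \<Longrightarrow> j \<in> IR \<Longrightarrow> infinitely_differentiable (E k j)"
    and eq1: "\<And>\<alpha> i. i \<in> IS \<Longrightarrow> (\<Sum>j\<in>IS. KS j i * p j \<alpha>) + (\<Sum>k\<in>IL. C k i * l k \<alpha>) = fS i"
    and eq2: "\<And>\<alpha> i. i \<in> IR \<Longrightarrow> (\<Sum>j\<in>IR. KR j i * q j \<alpha>) - (\<Sum>k\<in>IL. E k i \<alpha> * l k \<alpha>) = fR i"
    and eq3: "\<And>\<alpha> m. m \<in> IL \<Longrightarrow> (\<Sum>j\<in>IS. C m j * p j \<alpha>) - (\<Sum>j\<in>IR. E m j \<alpha> * q j \<alpha>) = 0"
    and ker: "\<And>\<alpha> p q l.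
      \<lbrakk>\<And>i. i \<in> IS \<Longrightarrow> (\<Sum>j\<in>IS. KS j i * p j) + (\<Sum>k\<in>IL. C k i * l k) = 0;
       \<And>i. i \<in> IR \<Longrightarrow> (\<Sum>j\<in>IR. KR j i * q j) - (\<Sum>k\<in>IL. E k i \<alpha> * l k) = 0;
       \<And>m. m \<in> IL \<Longrightarrow> (\<Sum>j\<in>IS. C m j * p j) - (\<Sum>j\<in>IR. E m j \<alpha> * q j) = 0\<rbrakk> \<Longrightarrow>
      (\<forall>i\<in>IS. p i = 0) \<and> (\<forall>i\<in>IR. q i = 0) \<and> (\<forall>k\<in>IL. l k = 0)"
  shows "j \<in> IR \<Longrightarrow> infinitely_differentiable (q j)"
    and "k \<in> IL \<Longrightarrow> infinitely_differentiable (l k)"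
proof -
  let ?I = "IS <+> (IR <+> IL)"
  define A :: "'a + 'b + 'c \<Rightarrow> 'a + 'b + 'c \<Rightarrow> real \<Rightarrow> real" where
    "A row col \<alpha> = (case row of
        Inl i \<Rightarrow> (case col of Inl j \<Rightarrow> KS j i | Inr (Inl j) \<Rightarrow> 0 | Inr (Inr k) \<Rightarrow> C k i)
      | Inr (Inl i) \<Rightarrow> (case col of Inl j \<Rightarrow> 0 | Inr (Inl j) \<Rightarrow> KR j i | Inr (Inr k) \<Rightarrow> - E k i \<alpha>)
      | Inr (Inr m) \<Rightarrow> (case col of Inl j \<Rightarrow> C m j | Inr (Inl j) \<Rightarrow> - E m j \<alpha> | Inr (Inr k) \<Rightarrow> 0))" for row col \<alpha>
  define b :: "'a + 'b + 'c \<Rightarrow> real \<Rightarrow> real" where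
    "b row \<alpha> = (case row of Inl i \<Rightarrow> fS i | Inr (Inl i) \<Rightarrow> fR i | Inr (Inr m) \<Rightarrow> 0)" for row \<alpha>
  define x :: "'a + 'b + 'c \<Rightarrow> real \<Rightarrow> real" where
    "x = case_sum p (case_sum q l)"
  have sum_I: "(\<Sum>col\<in>?I. g col) =
      (\<Sum>j\<in>IS. g (Inl j)) + ((\<Sum>j\<in>IR. g (Inr (Inl j))) + (\<Sum>k\<in>IL. g (Inr (Inr k))))" for g :: "_ \<Rightarrow> real"
    using fin by (simp add: sum.Plus)
  have "infinitely_differentiable (x i)" if "i \<in> ?I" for i
  proof (rule linear_system_smooth[of ?I A b x])
    fix row col assume "row \<in> ?I" "col \<in> ?I"
    then show "infinitely_differentiable (A row col)"
      unfolding A_def by (auto split: sum.split intro!: smooth_const smooth_minus E)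
  next
    fix row show "infinitely_differentiable (b row)"
      unfolding b_def by (rule smooth_const)
  next
    fix \<alpha> row assume "row \<in> ?I"
    then show "(\<Sum>col\<in>?I. A row col \<alpha> * x col \<alpha>) = b row \<alpha>"
      unfolding sum_I using eq1 eq2 eq3
      by (auto simp: A_def b_def x_def sum_negf split: sum.split)
  next
    fix \<alpha> y row assume y: "\<And>row. row \<in> ?I \<Longrightarrow> (\<Sum>col\<in>?I. A row col \<alpha> * y col) = 0" and row: "row \<in> ?I"
    have "(\<forall>i\<in>IS. y (Inl i) = 0) \<and> (\<forall>i\<in>IR. y (Inr (Inl i)) = 0) \<and> (\<forall>k\<in>IL. y (Inr (Inr k)) = 0)"
    proof (rule ker)
      fix i assume "i \<in> IS"
      then show "(\<Sum>j\<in>IS. KS j i * y (Inl j)) + (\<Sum>k\<in>IL. C k i * y (Inr (Inr k))) = 0"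
        using y[of "Inl i", OF InlI] unfolding sum_I by (simp add: A_def)
    next
      fix i assume "i \<in> IR"
      then show "(\<Sum>j\<in>IR. KR j i * y (Inr (Inl j))) - (\<Sum>k\<in>IL. E k i \<alpha> * y (Inr (Inr k))) = 0"
        using y[of "Inr (Inl i)", OF InrI[OF InlI]] unfolding sum_I by (simp add: A_def sum_negf)
    next
      fix m assume "m \<in> IL"
      then show "(\<Sum>j\<in>IS. C m j * y (Inl j)) - (\<Sum>j\<in>IR. E m j \<alpha> * y (Inr (Inl j))) = 0"
        using y[of "Inr (Inr m)", OF InrI[OF InrI]] unfolding sum_I by (simp add: A_def sum_negf)
    qed
    then show "y row = 0" using row by auto
  qed (use fin that in auto)
  from this[of "Inr (Inl j)", OF InrI[OF InlI]] this[of "Inr (Inr k)", OF InrI[OF InrI]]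
  show "j \<in> IR \<Longrightarrow> infinitely_differentiable (q j)" "k \<in> IL \<Longrightarrow> infinitely_differentiable (l k)"
    by (simp_all add: x_def)
qed

section \<open>Product test functions\<close>

text \<open>The derivatives of \<open>exp (- 1 / t)\<close>, extended by zero to the left, are linear combinations of
  functions of this form, so the whole family is differentiated at once.\<close>

definition flat :: "nat \<Rightarrow> real \<Rightarrow> real" where
  "flat k t = (if t > 0 then exp (- 1 / t) / t ^ k else 0)"

lemma flat_tendsto_0: "(flat k \<longlongrightarrow> 0) (at 0)"
proof (rule filterlim_split_at)
  show "(flat k \<longlongrightarrow> 0) (at_left 0)"
    by (rule tendsto_eventually) (auto simp: eventually_at_filter flat_def)
  have "((\<lambda>t. inverse t ^ k / exp (inverse t)) \<longlongrightarrow> 0) (at_right (0::real))"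
    by (rule filterlim_compose[OF tendsto_power_div_exp_0 filterlim_inverse_at_top_right])
  then show "(flat k \<longlongrightarrow> 0) (at_right 0)"
    by (rule Lim_transform_eventually)
      (auto simp: eventually_at_filter flat_def exp_minus field_simps)
qed

lemma DERIV_flat:
  "(flat k has_real_derivative flat (k + 2) t - real k * flat (k + 1) t) (at t)"
proof (cases t "0::real" rule: linorder_cases)
  case less
  have "((\<lambda>t. 0) has_real_derivative 0) (at t)" by simp
  then have "(flat k has_real_derivative 0) (at t)"
    by (rule has_field_derivative_transform_within_open[where S = "{..<0}"])
      (use less in \<open>auto simp: flat_def\<close>)
  then show ?thesis using less by (simp add: flat_def)
next
  case equal
  have "((\<lambda>h. (flat k (0 + h) - flat k 0) / h) \<longlongrightarrow> 0) (at 0)"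
    by (rule Lim_transform_eventually[OF flat_tendsto_0[of "k + 1"]])
      (auto simp: eventually_at_filter flat_def field_simps)
  then have "(flat k has_real_derivative 0) (at 0)"
    by (simp add: DERIV_def)
  then show ?thesis using equal by (simp add: flat_def)
next
  case greater
  have "((\<lambda>t. exp (- 1 / t) / t ^ k) has_real_derivative
      (exp (- 1 / t) * (1 / t\<^sup>2) * t ^ k - exp (- 1 / t) * (real k * t ^ (k - 1))) / (t ^ k * t ^ k)) (at t)"
    using greater by (auto intro!: derivative_eq_intros simp: power2_eq_square)
  also have "(exp (- 1 / t) * (1 / t\<^sup>2) * t ^ k - exp (- 1 / t) * (real k * t ^ (k - 1))) / (t ^ k * t ^ k)
      = exp (- 1 / t) / t ^ (k + 2) - real k * (exp (- 1 / t) / t ^ (k + 1))"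
    using greater by (cases k) (simp_all add: field_simps power2_eq_square)
  finally have "(flat k has_real_derivative
      exp (- 1 / t) / t ^ (k + 2) - real k * (exp (- 1 / t) / t ^ (k + 1))) (at t)"
    by (rule has_field_derivative_transform_within_open[where S = "{0<..}"])
      (use greater in \<open>auto simp: flat_def\<close>)
  then show ?thesis using greater by (simp add: flat_def)
qed

lemma smooth_flat: "infinitely_differentiable (flat k)"
proof -
  have "diff_times n (flat k)" for n
  proof (induction n arbitrary: k)
    case (Suc n)
    have "diff_times n (\<lambda>t. flat (k + 2) t + (- real k) * flat (k + 1) t)"
      by (intro diff_times_add diff_times_mult diff_times_const Suc)
    then show ?case
      by (intro diff_times_SucI[OF DERIV_flat]) simp
  qed simp
  then show ?thesis by (simp add: infinitely_differentiable_iff)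
qed

lemma flat_0_bounds: "0 \<le> flat 0 t" "flat 0 t \<le> 1"
  by (auto simp: flat_def)

lemma flat_rescaled_tendsto:
  "(\<lambda>n. flat 0 (real (Suc n) * s)) \<longlonglongrightarrow> (if s > 0 then 1 else 0)"
proof (cases "s > 0")
  case True
  have "(\<lambda>n. exp (- (inverse (real (Suc n)) * (1 / s)))) \<longlonglongrightarrow> exp (- (0 * (1 / s)))"
    by (intro tendsto_intros LIMSEQ_inverse_real_of_nat)
  moreover have "flat 0 (real (Suc n) * s) = exp (- (inverse (real (Suc n)) * (1 / s)))" for n
    using True by (simp add: flat_def field_simps zero_less_mult_iff del: of_nat_Suc)
  ultimately show ?thesis using True by simp
next
  case False
  then have "flat 0 (real (Suc n) * s) = 0" for n
    by (simp add: flat_def mult_le_0_iff not_less del: of_nat_Suc)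
  then show ?thesis using False by simp
qed

lemma Ck_on_tensor:
  assumes "infinitely_differentiable u" "infinitely_differentiable w"
  shows "Ck_on k UNIV (\<lambda>x. u (x$1) * w (x$2))"
  using assms
proof (induction k arbitrary: u w)
  case 0
  have cont: "continuous_on UNIV u" "continuous_on UNIV w"
    using 0 smooth_continuous_on by simp_all
  have "continuous_on UNIV (\<lambda>x::real^2. u (x$1))" "continuous_on UNIV (\<lambda>x::real^2. w (x$2))"
    by (rule continuous_on_compose2[OF cont(1)] continuous_on_compose2[OF cont(2)],
        auto intro!: continuous_intros)+
  then show ?case by (simp add: continuous_on_mult)
next
  case (Suc k)
  have der: "((\<lambda>x::real^2. u (x$1) * w (x$2)) has_derivative
      (\<lambda>h. u (x$1) * (deriv w (x$2) * h$2) + (deriv u (x$1) * h$1) * w (x$2))) (at x)" for x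
  proof (rule has_derivative_mult)
    show "((\<lambda>x::real^2. u (x$1)) has_derivative (\<lambda>h. deriv u (x$1) * h$1)) (at x)"
      by (rule has_derivative_compose[where f = "\<lambda>x. x$1"])
        (use smooth_deriv(1)[OF Suc.prems(1)] in \<open>auto simp: has_field_derivative_def
          intro!: bounded_linear_imp_has_derivative bounded_linear_vec_nth\<close>)
    show "((\<lambda>x::real^2. w (x$2)) has_derivative (\<lambda>h. deriv w (x$2) * h$2)) (at x)"
      by (rule has_derivative_compose[where f = "\<lambda>x. x$2"])
        (use smooth_deriv(1)[OF Suc.prems(2)] in \<open>auto simp: has_field_derivative_def
          intro!: bounded_linear_imp_has_derivative bounded_linear_vec_nth\<close>)
  qed
  have "frechet_derivative (\<lambda>x::real^2. u (x$1) * w (x$2)) (at x) =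
      (\<lambda>h. u (x$1) * (deriv w (x$2) * h$2) + (deriv u (x$1) * h$1) * w (x$2))" for x
    using frechet_derivative_at[OF der] by simp
  then have "partial_deriv 1 (\<lambda>x. u (x$1) * w (x$2)) = (\<lambda>x. deriv u (x$1) * w (x$2))"
    "partial_deriv 2 (\<lambda>x. u (x$1) * w (x$2)) = (\<lambda>x. u (x$1) * deriv w (x$2))"
    by (auto simp: partial_deriv_def axis_def fun_eq_iff)
  then have "Ck_on k UNIV (partial_deriv i (\<lambda>x. u (x$1) * w (x$2)))" for i
    using Suc.IH smooth_deriv(2) Suc.prems exhaust_2[of i] by (metis (no_types))
  moreover have "(\<lambda>x::real^2. u (x$1) * w (x$2)) differentiable_on UNIV"
    using der by (auto simp: differentiable_on_def differentiable_def)
  ultimately show ?case by simp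
qed

text \<open>With growing \<open>n\<close> these functions increase to the indicator of the box. They make mollification
  unnecessary: testing against them already yields the integrals over boxes.\<close>

definition box_bump :: "nat \<Rightarrow> real^2 \<Rightarrow> real^2 \<Rightarrow> real^2 \<Rightarrow> real" where
  "box_bump n a b x = (\<Prod>i\<in>UNIV. flat 0 (real (Suc n) * (x$i - a$i)) * flat 0 (real (Suc n) * (b$i - x$i)))"

lemma test_function_box_bump:
  assumes "cbox a b \<subseteq> \<Omega>"
  shows "test_function \<Omega> (box_bump n a b)"
proof -
  define u where "u = (\<lambda>i t. flat 0 (real (Suc n) * t + (- real (Suc n) * a$i)) *
    flat 0 (- real (Suc n) * t + real (Suc n) * b$i))"
  have u: "infinitely_differentiable (u i)" for i
    unfolding u_def by (intro smooth_mult smooth_affine smooth_flat)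
  have "box_bump n a b = (\<lambda>x. u 1 (x$1) * u 2 (x$2))"
    by (auto simp: box_bump_def u_def UNIV_2 fun_eq_iff algebra_simps)
  then have "Ck_on k UNIV (box_bump n a b)" for k
    using Ck_on_tensor[OF u u] by simp
  moreover have "{x. box_bump n a b x \<noteq> 0} \<subseteq> cbox a b"
    by (auto simp: box_bump_def mem_box_cart flat_def zero_less_mult_iff less_imp_le
        simp del: of_nat_Suc split: if_splits)
  then have "closure {x. box_bump n a b x \<noteq> 0} \<subseteq> cbox a b"
    by (rule closure_minimal[OF _ closed_cbox])
  then have "compact (closure {x. box_bump n a b x \<noteq> 0})"
    by (metis bounded_cbox bounded_subset closed_closure compact_eq_bounded_closed)
  ultimately show ?thesis
    using assms \<open>closure _ \<subseteq> cbox a b\<close> by (auto simp: test_function_def smooth_on_def)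
qed

lemma box_bump_bounds: "0 \<le> box_bump n a b x" "box_bump n a b x \<le> 1"
  unfolding box_bump_def
  by (intro prod_nonneg prod_le_1 ballI conjI mult_nonneg_nonneg mult_le_one flat_0_bounds)+

lemma box_bump_tendsto: "(\<lambda>n. box_bump n a b x) \<longlonglongrightarrow> indicator (box a b) x"
proof -
  have "(\<lambda>n. box_bump n a b x) \<longlonglongrightarrow>
      (\<Prod>i\<in>UNIV. (if x$i - a$i > 0 then 1 else 0) * (if b$i - x$i > 0 then 1 else 0))"
    unfolding box_bump_def by (intro tendsto_intros flat_rescaled_tendsto)
  also have "(\<Prod>i\<in>UNIV. (if x$i - a$i > 0 then 1 else 0) * (if b$i - x$i > 0 then 1 else 0))
      = (indicator (box a b) x :: real)"
    by (auto simp: UNIV_2 indicator_def mem_box_cart forall_2)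
  finally show ?thesis .
qed

lemma test_function_continuous:
  assumes "test_function \<Omega> \<phi>"
  shows "continuous_on UNIV \<phi>" "continuous_on UNIV (grad \<phi>)"
proof -
  have Ck: "Ck_on k UNIV \<phi>" for k
    using assms by (auto simp: test_function_def smooth_on_def)
  show "continuous_on UNIV \<phi>" using Ck[of 0] by simp
  have "continuous_on UNIV (partial_deriv i \<phi>)" for i
    using Ck[of "Suc 0"] by simp
  then show "continuous_on UNIV (grad \<phi>)"
    unfolding grad_def[abs_def] by (intro continuous_intros) auto
qed

text \<open>Boxes are an intersection-stable generator of the Borel sets; the total integral, needed for
  complements, is the limit over the boxes exhausting the space.\<close>

lemma AE_zero_of_box_integrals:
  fixes f :: "'a::euclidean_space \<Rightarrow> real"
  assumes f: "integrable lborel f"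
    and box: "\<And>a b. (LINT x:box a b|lborel. f x) = 0"
  shows "AE x in lborel. f x = 0"
proof (rule sigma_finite_measure.density_zero[OF sigma_finite_lborel f])
  have f_on [simp]: "set_integrable lborel A f" if "A \<in> sets lborel" for A
    using that f integrable_mult_indicator unfolding set_integrable_def by blast
  let ?B = "\<lambda>n::nat. box (- (real n *\<^sub>R One)) (real n *\<^sub>R One) :: 'a set"
  have "(\<lambda>n. LINT x:?B n|lborel. f x) \<longlonglongrightarrow> (LINT x:(\<Union>n. ?B n)|lborel. f x)"
    by (rule set_integral_cont_up) (auto simp: incseq_def subset_box)
  then have total: "(LINT x:UNIV|lborel. f x) = 0"
    unfolding box UN_box_eq_UNIV using LIMSEQ_unique tendsto_const by blast
  fix A :: "'a set" assume A: "A \<in> sets lborel"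
  have "Int_stable (range (\<lambda>(a, b). box a b :: 'a set))"
    by (auto simp: Int_stable_def box_Int_box)
  moreover have "range (\<lambda>(a, b). box a b :: 'a set) \<subseteq> Pow UNIV" by auto
  moreover have "A \<in> sigma_sets UNIV (range (\<lambda>(a, b). box a b))"
    using A unfolding sets_lborel borel_eq_box by simp
  ultimately show "(LINT x:A|lborel. f x) = 0"
  proof (induction rule: sigma_sets_induct_disjoint)
    case (basic A)
    then show ?case using box by auto
  next
    case empty
    show ?case by (simp add: set_lebesgue_integral_def)
  next
    case (compl A)
    then have [measurable]: "A \<in> sets borel" by (simp add: borel_eq_box)
    have "(LINT x:A \<union> (UNIV - A)|lborel. f x) = (LINT x:A|lborel. f x) + (LINT x:UNIV - A|lborel. f x)"
      by (rule set_integral_Un) auto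
    then show ?case using total compl.IH by simp
  next
    case (union F)
    then have [measurable]: "\<And>i. F i \<in> sets borel" by (auto simp: borel_eq_box)
    have "(LINT x:(\<Union>i. F i)|lborel. f x) = (\<Sum>i. LINT x:F i|lborel. f x)"
      by (rule lebesgue_integral_countable_add)
        (use union(1) in \<open>auto simp: disjoint_family_on_def\<close>)
    then show ?case using union.IH by simp
  qed
qed

section \<open>The fundamental lemma and linearity of the weak gradient\<close>

lemma integral_box_eq_0:
  fixes g :: "real^2 \<Rightarrow> real"
  assumes \<Omega>: "open \<Omega>" and g: "integrable (lebesgue_on \<Omega>) g"
    and test: "\<And>\<phi>. test_function \<Omega> \<phi> \<Longrightarrow> (LINT x|lebesgue_on \<Omega>. \<phi> x * g x) = 0"
    and ab: "cbox a b \<subseteq> \<Omega>"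
  shows "(LINT x|lebesgue_on \<Omega>. indicator (box a b) x * g x) = 0"
proof -
  have meas: "\<phi> \<in> borel_measurable (lebesgue_on \<Omega>)" if "continuous_on UNIV \<phi>" for \<phi> :: "real^2 \<Rightarrow> real"
    using that \<Omega> by (intro continuous_imp_measurable_on_sets_lebesgue) (auto intro: continuous_on_subset)
  have "(\<lambda>n. LINT x|lebesgue_on \<Omega>. box_bump n a b x * g x) \<longlonglongrightarrow>
      (LINT x|lebesgue_on \<Omega>. indicator (box a b) x * g x)"
  proof (rule integral_dominated_convergence[where w = "\<lambda>x. \<bar>g x\<bar>"])
    show "(\<lambda>x. box_bump n a b x * g x) \<in> borel_measurable (lebesgue_on \<Omega>)" for n
      using g meas[OF test_function_continuous(1)[OF test_function_box_bump[OF ab]]]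
      by (intro borel_measurable_times) auto
    have "(indicator (box a b) :: _ \<Rightarrow> real) \<in> borel_measurable (lebesgue_on \<Omega>)"
      using \<Omega> by (intro borel_measurable_indicator)
        (auto simp: sets_restrict_space intro!: image_eqI[of _ _ "box a b"] dest: set_mp[OF box_subset_cbox] set_mp[OF ab])
    then show "(\<lambda>x. indicator (box a b) x * g x) \<in> borel_measurable (lebesgue_on \<Omega>)"
      using g by (intro borel_measurable_times) auto
    show "AE x in lebesgue_on \<Omega>. (\<lambda>n. box_bump n a b x * g x) \<longlonglongrightarrow> indicator (box a b) x * g x"
      by (intro AE_I2 tendsto_mult box_bump_tendsto tendsto_const)
    show "AE x in lebesgue_on \<Omega>. norm (box_bump n a b x * g x) \<le> \<bar>g x\<bar>" for n
      using box_bump_bounds[of n a b] by (intro AE_I2) (simp add: abs_mult mult_left_le_one_le)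
  qed (use g in auto)
  moreover have "(LINT x|lebesgue_on \<Omega>. box_bump n a b x * g x) = 0" for n
    by (intro test test_function_box_bump ab)
  ultimately show ?thesis using LIMSEQ_unique tendsto_const by (metis (no_types, lifting) ext)
qed

text \<open>The fundamental lemma of the calculus of variations. Localized to a box whose closure lies in
  \<open>\<Omega>\<close> and extended by zero, the function has zero integral over every box of the plane; countably many closed boxes
  cover \<open>\<Omega>\<close>.\<close>

lemma AE_zero_of_test_integrals:
  fixes g :: "real^2 \<Rightarrow> real"
  assumes \<Omega>: "open \<Omega>" and g: "integrable (lebesgue_on \<Omega>) g"
    and test: "\<And>\<phi>. test_function \<Omega> \<phi> \<Longrightarrow> (LINT x|lebesgue_on \<Omega>. \<phi> x * g x) = 0"
  shows "AE x in lebesgue_on \<Omega>. g x = 0"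
proof -
  have \<Omega>_sets: "\<Omega> \<inter> space lebesgue \<in> sets lebesgue" using \<Omega> by simp
  have cell: "AE x in lebesgue. x \<in> cbox a b \<longrightarrow> g x = 0" if ab: "cbox a b \<subseteq> \<Omega>" for a b
  proof -
    define f where "f = (\<lambda>x. indicator (box a b) x * (indicator \<Omega> x * g x))"
    have "integrable lebesgue (\<lambda>x. indicator \<Omega> x * g x)"
      using g integrable_restrict_space[OF \<Omega>_sets, of g] by simp
    then have f: "integrable lebesgue f"
      unfolding f_def using integrable_mult_indicator[of "box a b" lebesgue "\<lambda>x. indicator \<Omega> x * g x"] by simp
    then obtain h where h: "h \<in> borel_measurable lborel" "AE x in lborel. f x = h x"
      using completion_ex_borel_measurable_real[of f lborel] by auto
    have h_eq: "AE x in lebesgue. f x = h x"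
      using AE_completion[OF h(2)] .
    have h_int: "integrable lborel h"
    proof -
      have "integrable lebesgue h"
        using f h_eq h(1) measurable_completion[OF h(1)]
        by (subst integrable_cong_AE[of h lebesgue f]) auto
      then show ?thesis using h(1) integrable_completion[of h lborel] by simp
    qed
    have "(LINT x:box c d|lborel. h x) = 0" for c d
    proof -
      obtain p q where pq: "box a b \<inter> box c d = box p q"
        using box_Int_box by blast
      have pq\<Omega>: "box p q = {} \<or> cbox p q \<subseteq> \<Omega>"
      proof (cases "box p q = {}")
        case False
        then have "cbox p q = closure (box p q)" by simp
        also have "\<dots> \<subseteq> cbox a b"
          using pq box_subset_cbox[of a b] by (intro closure_minimal[OF _ closed_cbox]) blast
        finally show ?thesis using ab by blast
      qed simp
      have "(LINT x:box c d|lborel. h x) = (LINT x|lebesgue. indicator (box c d) x * h x)"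
        using h(1) by (simp add: set_lebesgue_integral_def integral_completion)
      also have "\<dots> = (LINT x|lebesgue. indicator (box c d) x * f x)"
        using h_eq f h(1) measurable_completion[OF h(1)]
        by (intro integral_cong_AE borel_measurable_times borel_measurable_indicator) auto
      also have "\<dots> = (LINT x|lebesgue. indicator \<Omega> x *\<^sub>R (indicator (box p q) x * g x))"
        unfolding pq[symmetric] f_def by (intro Bochner_Integration.integral_cong) (auto simp: indicator_def)
      also have "\<dots> = (LINT x|lebesgue_on \<Omega>. indicator (box p q) x * g x)"
        using integral_restrict_space[OF \<Omega>_sets, of "\<lambda>x. indicator (box p q) x * g x"] by simp
      also have "\<dots> = 0"
        using pq\<Omega> integral_box_eq_0[OF \<Omega> g test] by auto
      finally show ?thesis .
    qed
    then have "AE x in lebesgue. h x = 0"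
      using AE_completion[OF AE_zero_of_box_integrals[OF h_int]] by blast
    moreover have "AE x in lebesgue. x \<notin> cbox a b - box a b"
      using negligible_frontier_interval[of a b] AE_not_in unfolding negligible_iff_null_sets by blast
    ultimately show ?thesis
      using h_eq
    proof eventually_elim
      case (elim x)
      then show ?case using ab by (auto simp: f_def indicator_def split: if_splits)
    qed
  qed
  obtain D where D: "countable D" "D \<subseteq> Pow \<Omega>" "\<And>X. X \<in> D \<Longrightarrow> \<exists>a b. X = cbox a b" "\<Union>D = \<Omega>"
    using open_countable_Union_open_cbox[OF \<Omega>] by blast
  have "AE x in lebesgue. \<forall>X\<in>D. x \<in> X \<longrightarrow> g x = 0"
    unfolding AE_ball_countable[OF D(1)]
  proof
    fix X assume "X \<in> D"
    then obtain a b where "X = cbox a b" "cbox a b \<subseteq> \<Omega>" using D(2,3) by blast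
    then show "AE x in lebesgue. x \<in> X \<longrightarrow> g x = 0" using cell by simp
  qed
  then have "AE x in lebesgue. x \<in> \<Omega> \<longrightarrow> g x = 0"
    by eventually_elim (use D(4) in auto)
  then show ?thesis
    by (simp add: AE_restrict_space_iff[OF \<Omega>_sets])
qed

lemma L2_add: "f \<in> L2 \<Omega> \<Longrightarrow> g \<in> L2 \<Omega> \<Longrightarrow> (\<lambda>x. f x + g x) \<in> L2 \<Omega>"
  for f :: "real^2 \<Rightarrow> 'b::euclidean_space"
proof -
  assume fg: "f \<in> L2 \<Omega>" "g \<in> L2 \<Omega>"
  have "(norm (u + v))\<^sup>2 \<le> 2 * (norm u)\<^sup>2 + 2 * (norm v)\<^sup>2" for u v :: 'b
  proof -
    have "(norm (u + v))\<^sup>2 \<le> (norm u + norm v)\<^sup>2"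
      by (intro power_mono norm_triangle_ineq) simp
    also have "\<dots> \<le> 2 * (norm u)\<^sup>2 + 2 * (norm v)\<^sup>2"
      using sum_squares_bound[of "norm u" "norm v"] by (simp add: power2_sum)
    finally show ?thesis .
  qed
  then have "integrable (lebesgue_on \<Omega>) (\<lambda>x. (norm (f x + g x))\<^sup>2)"
    using fg unfolding L2_def
    by (intro Bochner_Integration.integrable_bound[where
        f = "\<lambda>x. 2 * (norm (f x))\<^sup>2 + 2 * (norm (g x))\<^sup>2" and g = "\<lambda>x. (norm (f x + g x))\<^sup>2"]) auto
  then show ?thesis using fg by (auto simp: L2_def)
qed

lemma L2_scaleR: "f \<in> L2 \<Omega> \<Longrightarrow> (\<lambda>x. c *\<^sub>R f x) \<in> L2 \<Omega>"
  by (auto simp: L2_def power_mult_distrib)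

lemma L2_zero: "(\<lambda>x. 0) \<in> L2 \<Omega>"
  by (simp add: L2_def)

lemma L2_inner_integrable:
  fixes f g :: "real^2 \<Rightarrow> 'b::euclidean_space"
  assumes "f \<in> L2 \<Omega>" "g \<in> L2 \<Omega>"
  shows "integrable (lebesgue_on \<Omega>) (\<lambda>x. f x \<bullet> g x)"
proof (rule Bochner_Integration.integrable_bound[where f = "\<lambda>x. (norm (f x))\<^sup>2 + (norm (g x))\<^sup>2"])
  have "\<bar>u \<bullet> v\<bar> \<le> (norm u)\<^sup>2 + (norm v)\<^sup>2" for u v :: 'b
  proof -
    have "\<bar>u \<bullet> v\<bar> \<le> norm u * norm v" by (rule Cauchy_Schwarz_ineq2)
    also have "\<dots> \<le> 2 * (norm u * norm v)" by simp
    also have "\<dots> \<le> (norm u)\<^sup>2 + (norm v)\<^sup>2"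
      using sum_squares_bound[of "norm u" "norm v"] by simp
    finally show ?thesis .
  qed
  then show "AE x in lebesgue_on \<Omega>. norm (f x \<bullet> g x) \<le> norm ((norm (f x))\<^sup>2 + (norm (g x))\<^sup>2)"
    by (intro AE_I2) simp
qed (use assms in \<open>auto simp: L2_def\<close>)

lemma L2_coefficient:
  assumes "coefficient \<Omega> \<nu>" "f \<in> L2 \<Omega>"
  shows "(\<lambda>x. \<nu> x *\<^sub>R f x) \<in> L2 \<Omega>"
proof -
  obtain c C where C: "0 < c" "AE x in lebesgue_on \<Omega>. c \<le> \<nu> x \<and> \<nu> x \<le> C"
    and [measurable]: "\<nu> \<in> borel_measurable (lebesgue_on \<Omega>)"
    using assms(1) by (auto simp: coefficient_def)
  have [measurable]: "f \<in> borel_measurable (lebesgue_on \<Omega>)"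
    and f: "integrable (lebesgue_on \<Omega>) (\<lambda>x. (norm (f x))\<^sup>2)"
    using assms(2) by (auto simp: L2_def)
  have "integrable (lebesgue_on \<Omega>) (\<lambda>x. (norm (\<nu> x *\<^sub>R f x))\<^sup>2)"
  proof (rule Bochner_Integration.integrable_bound[where f = "\<lambda>x. C\<^sup>2 * (norm (f x))\<^sup>2"])
    show "AE x in lebesgue_on \<Omega>. norm ((norm (\<nu> x *\<^sub>R f x))\<^sup>2) \<le> norm (C\<^sup>2 * (norm (f x))\<^sup>2)"
      using C(2)
    proof eventually_elim
      case (elim x)
      then have "(\<nu> x)\<^sup>2 \<le> C\<^sup>2" using C(1) by (intro power_mono) auto
      then show ?case by (simp add: power_mult_distrib mult_right_mono)
    qed
  qed (use f in auto)
  then show ?thesis by (simp add: L2_def)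
qed

lemma L2_inner_cong_AE:
  assumes "f \<in> L2 \<Omega>" "f' \<in> L2 \<Omega>" "g \<in> L2 \<Omega>" "g' \<in> L2 \<Omega>"
    "AE x in lebesgue_on \<Omega>. f x = f' x" "AE x in lebesgue_on \<Omega>. g x = g' x"
  shows "L2_inner \<Omega> f g = L2_inner \<Omega> f' g'"
  unfolding L2_inner_def
proof (rule integral_cong_AE)
  show "AE x in lebesgue_on \<Omega>. f x \<bullet> g x = f' x \<bullet> g' x"
    using assms(5,6) by eventually_elim simp
qed (use assms L2_inner_integrable in blast)+

lemma integrable_one_on_bounded:
  assumes "open \<Omega>" "bounded \<Omega>"
  shows "integrable (lebesgue_on \<Omega>) (\<lambda>x. 1 :: real)"
  using lmeasurable_open[OF assms(2,1)] lmeasurable_iff_integrable[of \<Omega>]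
  by (simp add: integrable_restrict_space fmeasurableD)

lemma L2_imp_integrable:
  fixes f :: "real^2 \<Rightarrow> 'b::euclidean_space"
  assumes "open \<Omega>" "bounded \<Omega>" "f \<in> L2 \<Omega>"
  shows "integrable (lebesgue_on \<Omega>) f"
proof (rule Bochner_Integration.integrable_bound[where f = "\<lambda>x. 1 + (norm (f x))\<^sup>2"])
  show "integrable (lebesgue_on \<Omega>) (\<lambda>x. 1 + (norm (f x))\<^sup>2)"
    using assms(3) integrable_one_on_bounded[OF assms(1,2)] by (auto simp: L2_def)
  have "t \<le> 1 + t\<^sup>2" for t :: real
    using sum_squares_bound[of t 1] zero_le_power2[of t] by (simp, smt (verit))
  then show "AE x in lebesgue_on \<Omega>. norm (f x) \<le> norm (1 + (norm (f x))\<^sup>2)"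
    by (intro AE_I2) simp
qed (use assms in \<open>auto simp: L2_def\<close>)

lemma integrable_continuous_scaleR:
  fixes f :: "real^2 \<Rightarrow> 'b::euclidean_space"
  assumes \<Omega>: "open \<Omega>" "bounded \<Omega>" and "continuous_on UNIV \<psi>" "integrable (lebesgue_on \<Omega>) f"
  shows "integrable (lebesgue_on \<Omega>) (\<lambda>x. \<psi> x *\<^sub>R f x)"
proof -
  have "bounded (\<psi> ` closure \<Omega>)"
    using assms by (intro compact_imp_bounded compact_continuous_image)
      (auto intro: continuous_on_subset)
  then obtain B where B: "\<And>x. x \<in> \<Omega> \<Longrightarrow> \<bar>\<psi> x\<bar> \<le> B"
    unfolding bounded_iff using closure_subset by fastforce
  have [measurable]: "\<psi> \<in> borel_measurable (lebesgue_on \<Omega>)"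
    using assms by (intro continuous_imp_measurable_on_sets_lebesgue)
      (auto intro: continuous_on_subset)
  show ?thesis
  proof (rule Bochner_Integration.integrable_bound[where f = "\<lambda>x. B * norm (f x)"])
    show "AE x in lebesgue_on \<Omega>. norm (\<psi> x *\<^sub>R f x) \<le> norm (B * norm (f x))"
      using B by (intro AE_I2) (fastforce simp: abs_mult intro!: mult_right_mono)
  qed (use assms in auto)
qed

lemma weak_grad_unique:
  assumes \<Omega>: "open \<Omega>" "bounded \<Omega>" and G: "has_weak_grad \<Omega> v G" and H: "has_weak_grad \<Omega> v H"
  shows "AE x in lebesgue_on \<Omega>. G x = H x"
proof -
  have GH: "integrable (lebesgue_on \<Omega>) G" "integrable (lebesgue_on \<Omega>) H"
    using G H L2_imp_integrable[OF \<Omega>] by (auto simp: has_weak_grad_def)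
  have "AE x in lebesgue_on \<Omega>. (G x - H x) $ i = 0" for i
  proof (rule AE_zero_of_test_integrals[OF \<Omega>(1)])
    show "integrable (lebesgue_on \<Omega>) (\<lambda>x. (G x - H x) $ i)"
      by (intro integrable_bounded_linear[OF bounded_linear_vec_nth] Bochner_Integration.integrable_diff GH)
    fix \<phi> assume \<phi>: "test_function \<Omega> \<phi>"
    note cont = test_function_continuous(1)[OF \<phi>]
    note int = GH[THEN integrable_continuous_scaleR[OF \<Omega> cont]]
    have "(LINT x|lebesgue_on \<Omega>. \<phi> x *\<^sub>R G x) = (LINT x|lebesgue_on \<Omega>. \<phi> x *\<^sub>R H x)"
      using G H \<phi> by (simp add: has_weak_grad_def)
    then have "(LINT x|lebesgue_on \<Omega>. \<phi> x *\<^sub>R G x - \<phi> x *\<^sub>R H x) = 0"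
      by (simp add: Bochner_Integration.integral_diff int)
    then have "(LINT x|lebesgue_on \<Omega>. (\<phi> x *\<^sub>R G x - \<phi> x *\<^sub>R H x) $ i) = 0"
      using integral_bounded_linear[OF bounded_linear_vec_nth Bochner_Integration.integrable_diff[OF int], of i]
      by simp
    then show "(LINT x|lebesgue_on \<Omega>. \<phi> x * (G x - H x) $ i) = 0"
      by (simp add: algebra_simps)
  qed
  then have "AE x in lebesgue_on \<Omega>. \<forall>i\<in>UNIV. (G x - H x) $ i = 0"
    by (intro AE_finite_allI) auto
  then show ?thesis by eventually_elim (simp add: vec_eq_iff)
qed

lemma has_weak_grad_linear:
  assumes \<Omega>: "open \<Omega>" "bounded \<Omega>" and v: "has_weak_grad \<Omega> v G" and w: "has_weak_grad \<Omega> w H"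
  shows "has_weak_grad \<Omega> (\<lambda>x. c * v x + w x) (\<lambda>x. c *\<^sub>R G x + H x)"
proof -
  have L2: "v \<in> L2 \<Omega>" "w \<in> L2 \<Omega>" "G \<in> L2 \<Omega>" "H \<in> L2 \<Omega>"
    using v w by (auto simp: has_weak_grad_def)
  have "(LINT x|lebesgue_on \<Omega>. (c * v x + w x) *\<^sub>R grad \<phi> x) =
      - (LINT x|lebesgue_on \<Omega>. \<phi> x *\<^sub>R (c *\<^sub>R G x + H x))" if \<phi>: "test_function \<Omega> \<phi>" for \<phi>
  proof -
    note cont = test_function_continuous[OF \<phi>]
    have int: "integrable (lebesgue_on \<Omega>) (\<lambda>x. \<phi> x *\<^sub>R G x)" "integrable (lebesgue_on \<Omega>) (\<lambda>x. \<phi> x *\<^sub>R H x)"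
      by (intro integrable_continuous_scaleR[OF \<Omega> cont(1)] L2_imp_integrable[OF \<Omega>] L2)+
    have int': "integrable (lebesgue_on \<Omega>) (\<lambda>x. u x *\<^sub>R grad \<phi> x)" if u: "u \<in> L2 \<Omega>" for u
    proof -
      have "grad \<phi> \<in> L2 \<Omega>"
      proof -
        have "continuous_on UNIV (\<lambda>x. (norm (grad \<phi> x))\<^sup>2)"
          by (intro continuous_intros cont)
        from integrable_continuous_scaleR[OF \<Omega> this integrable_one_on_bounded[OF \<Omega>]]
        have "integrable (lebesgue_on \<Omega>) (\<lambda>x. (norm (grad \<phi> x))\<^sup>2)"
          by simp
        moreover have "grad \<phi> \<in> borel_measurable (lebesgue_on \<Omega>)"
          using \<Omega> cont by (intro continuous_imp_measurable_on_sets_lebesgue)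
            (auto intro: continuous_on_subset)
        ultimately show ?thesis by (simp add: L2_def)
      qed
      then have prod: "integrable (lebesgue_on \<Omega>) (\<lambda>x. \<bar>u x\<bar> * norm (grad \<phi> x))"
        using L2_inner_integrable[of "\<lambda>x. \<bar>u x\<bar>" \<Omega> "\<lambda>x. norm (grad \<phi> x)"] u
        by (auto simp: L2_def)
      show ?thesis
        by (rule Bochner_Integration.integrable_bound[OF prod])
          (use u \<open>grad \<phi> \<in> L2 \<Omega>\<close> in \<open>auto simp: L2_def\<close>)
    qed
    have "(LINT x|lebesgue_on \<Omega>. (c * v x + w x) *\<^sub>R grad \<phi> x) =
        c *\<^sub>R (LINT x|lebesgue_on \<Omega>. v x *\<^sub>R grad \<phi> x) + (LINT x|lebesgue_on \<Omega>. w x *\<^sub>R grad \<phi> x)"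
      using int' L2 by (simp add: scaleR_add_left flip: scaleR_scaleR)
    also have "\<dots> = - (c *\<^sub>R (LINT x|lebesgue_on \<Omega>. \<phi> x *\<^sub>R G x) + (LINT x|lebesgue_on \<Omega>. \<phi> x *\<^sub>R H x))"
      using v w \<phi> by (simp add: has_weak_grad_def)
    also have "c *\<^sub>R (LINT x|lebesgue_on \<Omega>. \<phi> x *\<^sub>R G x) + (LINT x|lebesgue_on \<Omega>. \<phi> x *\<^sub>R H x) =
        (LINT x|lebesgue_on \<Omega>. c *\<^sub>R (\<phi> x *\<^sub>R G x) + \<phi> x *\<^sub>R H x)"
      using int by (subst Bochner_Integration.integral_add) (auto simp del: scaleR_scaleR)
    finally show ?thesis by (simp add: algebra_simps)
  qed
  moreover have "(\<lambda>x. c * v x + w x) \<in> L2 \<Omega>" "(\<lambda>x. c *\<^sub>R G x + H x) \<in> L2 \<Omega>"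
    using L2_add[OF L2_scaleR[of _ _ c]] L2 by fastforce+
  ultimately show ?thesis by (simp add: has_weak_grad_def)
qed

lemma has_weak_grad_sum:
  assumes \<Omega>: "open \<Omega>" "bounded \<Omega>" and "finite I"
    and "\<And>i. i \<in> I \<Longrightarrow> has_weak_grad \<Omega> (e i) (G i)"
  shows "has_weak_grad \<Omega> (\<lambda>x. \<Sum>i\<in>I. c i * e i x) (\<lambda>x. \<Sum>i\<in>I. c i *\<^sub>R G i x)"
  using assms(3,4)
proof (induction I rule: finite_induct)
  case empty
  then show ?case by (simp add: has_weak_grad_def L2_zero)
next
  case (insert i I)
  then show ?case using has_weak_grad_linear[OF \<Omega>, of "e i" "G i" _ _ "c i"] by simp
qed

lemma has_weak_grad_weak_grad: "v \<in> H1 \<Omega> \<Longrightarrow> has_weak_grad \<Omega> v (weak_grad \<Omega> v)"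
  unfolding H1_def weak_grad_def by (simp add: some_eq_ex)

lemma weak_grad_L2: "v \<in> H1 \<Omega> \<Longrightarrow> weak_grad \<Omega> v \<in> L2 \<Omega>"
  using has_weak_grad_weak_grad by (auto simp: has_weak_grad_def)

text \<open>The choice of representative in \<open>weak_grad\<close> costs exact linearity, but not linearity almost
  everywhere, which is all that the integrals see.\<close>

lemma weak_grad_sum:
  fixes c :: "'i \<Rightarrow> real"
  assumes \<Omega>: "open \<Omega>" "bounded \<Omega>" and I: "finite I" "\<And>i. i \<in> I \<Longrightarrow> e i \<in> H1 \<Omega>"
  shows "AE x in lebesgue_on \<Omega>.
    weak_grad \<Omega> (\<lambda>x. \<Sum>i\<in>I. c i * e i x) x = (\<Sum>i\<in>I. c i *\<^sub>R weak_grad \<Omega> (e i) x)"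
    and "(\<lambda>x. \<Sum>i\<in>I. c i * e i x) \<in> H1 \<Omega>"
proof -
  have sum: "has_weak_grad \<Omega> (\<lambda>x. \<Sum>i\<in>I. c i * e i x) (\<lambda>x. \<Sum>i\<in>I. c i *\<^sub>R weak_grad \<Omega> (e i) x)"
    by (intro has_weak_grad_sum \<Omega> I has_weak_grad_weak_grad)
  then show "(\<lambda>x. \<Sum>i\<in>I. c i * e i x) \<in> H1 \<Omega>" by (auto simp: H1_def)
  then show "AE x in lebesgue_on \<Omega>.
    weak_grad \<Omega> (\<lambda>x. \<Sum>i\<in>I. c i * e i x) x = (\<Sum>i\<in>I. c i *\<^sub>R weak_grad \<Omega> (e i) x)"
    using weak_grad_unique[OF \<Omega> has_weak_grad_weak_grad sum] by simp
qed

lemma L2_sum: "finite I \<Longrightarrow> (\<And>i. i \<in> I \<Longrightarrow> f i \<in> L2 \<Omega>) \<Longrightarrow> (\<lambda>x. \<Sum>i\<in>I. c i *\<^sub>R f i x) \<in> L2 \<Omega>"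
  by (induction I rule: finite_induct) (simp_all add: L2_zero L2_add L2_scaleR)

lemma L2_inner_weak_grad_sum:
  assumes \<Omega>: "open \<Omega>" "bounded \<Omega>" and I: "finite I" "\<And>i. i \<in> I \<Longrightarrow> e i \<in> H1 \<Omega>"
    and F: "F \<in> L2 \<Omega>"
  shows "L2_inner \<Omega> F (weak_grad \<Omega> (\<lambda>x. \<Sum>i\<in>I. c i * e i x)) =
    (\<Sum>i\<in>I. c i * L2_inner \<Omega> F (weak_grad \<Omega> (e i)))"
proof -
  note wg = weak_grad_L2[OF I(2)]
  have "L2_inner \<Omega> F (weak_grad \<Omega> (\<lambda>x. \<Sum>i\<in>I. c i * e i x)) =
      L2_inner \<Omega> F (\<lambda>x. \<Sum>i\<in>I. c i *\<^sub>R weak_grad \<Omega> (e i) x)"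
    using weak_grad_sum[OF \<Omega> I] weak_grad_L2 by (intro L2_inner_cong_AE F L2_sum I wg) auto
  also have "\<dots> = (\<Sum>i\<in>I. c i * L2_inner \<Omega> F (weak_grad \<Omega> (e i)))"
    unfolding L2_inner_def inner_sum_right inner_scaleR_right
    using L2_inner_integrable[OF F wg] by (subst Bochner_Integration.integral_sum) auto
  finally show ?thesis .
qed

lemma stiffness_sum:
  assumes \<Omega>: "open \<Omega>" "bounded \<Omega>" and I: "finite I" "\<And>i. i \<in> I \<Longrightarrow> e i \<in> H1 \<Omega>"
    and \<nu>: "coefficient \<Omega> \<nu>" and w: "w \<in> H1 \<Omega>"
  shows "L2_inner \<Omega> (\<lambda>x. \<nu> x *\<^sub>R weak_grad \<Omega> (\<lambda>x. \<Sum>i\<in>I. c i * e i x) x) (weak_grad \<Omega> w) =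
    (\<Sum>i\<in>I. c i * L2_inner \<Omega> (\<lambda>x. \<nu> x *\<^sub>R weak_grad \<Omega> (e i) x) (weak_grad \<Omega> w))"
proof -
  have swap: "L2_inner \<Omega> (\<lambda>x. \<nu> x *\<^sub>R F x) H = L2_inner \<Omega> (\<lambda>x. \<nu> x *\<^sub>R H x) F" for F H
    by (simp add: L2_inner_def inner_commute)
  show ?thesis
    unfolding swap[of _ "weak_grad \<Omega> w"]
    by (rule L2_inner_weak_grad_sum[OF \<Omega> I L2_coefficient[OF \<nu> weak_grad_L2[OF w]]])
qed

lemma L2_inner_sum:
  fixes F :: "real^2 \<Rightarrow> real"
  assumes I: "finite I" "\<And>i. i \<in> I \<Longrightarrow> e i \<in> L2 \<Omega>" and F: "F \<in> L2 \<Omega>"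
  shows "L2_inner \<Omega> F (\<lambda>x. \<Sum>i\<in>I. c i * e i x) = (\<Sum>i\<in>I. c i * L2_inner \<Omega> F (e i))"
proof -
  have "integrable (lebesgue_on \<Omega>) (\<lambda>x. F x * e i x)" if "i \<in> I" for i
    using L2_inner_integrable[OF F I(2)[OF that]] by simp
  then show ?thesis
    unfolding L2_inner_def inner_real_def sum_distrib_left mult.left_commute[of "F _"]
    by (subst Bochner_Integration.integral_sum) auto
qed

section \<open>Bases of finite-dimensional function spaces\<close>

definition spans :: "'i set \<Rightarrow> ('i \<Rightarrow> real^2 \<Rightarrow> real) \<Rightarrow> (real^2 \<Rightarrow> real) set \<Rightarrow> bool" where
  "spans I e V \<longleftrightarrow> finite I \<and> V = {(\<lambda>x. \<Sum>i\<in>I. c i * e i x) | c. True}"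

definition lin_indep :: "'i set \<Rightarrow> ('i \<Rightarrow> real^2 \<Rightarrow> real) \<Rightarrow> bool" where
  "lin_indep I e \<longleftrightarrow> (\<forall>c. (\<forall>x. (\<Sum>i\<in>I. c i * e i x) = 0) \<longrightarrow> (\<forall>i\<in>I. c i = 0))"

lemma spans_mem: "spans I e V \<Longrightarrow> (\<lambda>x. \<Sum>i\<in>I. c i * e i x) \<in> V"
  by (auto simp: spans_def)

lemma spans_basis_mem:
  assumes "spans I e V" "i \<in> I"
  shows "e i \<in> V"
proof -
  have "(\<lambda>x. \<Sum>j\<in>I. (if j = i then 1 else 0) * e j x) = e i"
    using assms by (simp add: spans_def fun_eq_iff sum.remove[of I i])
  then show ?thesis using spans_mem[OF assms(1)] by metis
qed

text \<open>Independence is needed to turn uniqueness of the solution into uniqueness of its coefficients.\<close>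

lemma ex_basis:
  assumes "spans I e V"
  shows "\<exists>J\<subseteq>I. spans J e V \<and> lin_indep J e"
proof -
  have "finite I" using assms by (simp add: spans_def)
  then show ?thesis using assms
  proof (induction I rule: finite_psubset_induct)
    case (psubset I)
    show ?case
    proof (cases "lin_indep I e")
      case False
      then obtain c k where c: "\<And>x. (\<Sum>i\<in>I. c i * e i x) = 0" and k: "k \<in> I" "c k \<noteq> 0"
        by (auto simp: lin_indep_def)
      \<comment> \<open>subtract the multiple of the relation \<open>c\<close> that cancels the coefficient of \<open>k\<close>\<close>
      have "\<exists>d'. (\<lambda>x. \<Sum>i\<in>I. d i * e i x) = (\<lambda>x. \<Sum>i\<in>I - {k}. d' i * e i x)" for d
      proof
        show "(\<lambda>x. \<Sum>i\<in>I. d i * e i x) = (\<lambda>x. \<Sum>i\<in>I - {k}. (d i - d k / c k * c i) * e i x)"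
        proof
          fix x
          have "(\<Sum>i\<in>I - {k}. (d i - d k / c k * c i) * e i x) = (\<Sum>i\<in>I. (d i - d k / c k * c i) * e i x)"
            using k psubset.hyps by (intro sum.mono_neutral_left) auto
          also have "\<dots> = (\<Sum>i\<in>I. d i * e i x) - d k / c k * (\<Sum>i\<in>I. c i * e i x)"
            by (simp add: left_diff_distrib sum_subtractf sum_distrib_left mult.assoc)
          finally show "(\<Sum>i\<in>I. d i * e i x) = (\<Sum>i\<in>I - {k}. (d i - d k / c k * c i) * e i x)"
            by (simp add: c)
        qed
      qed
      moreover have "\<exists>d'. (\<lambda>x. \<Sum>i\<in>I - {k}. d i * e i x) = (\<lambda>x. \<Sum>i\<in>I. d' i * e i x)" for d
      proof
        show "(\<lambda>x. \<Sum>i\<in>I - {k}. d i * e i x) = (\<lambda>x. \<Sum>i\<in>I. (d(k := 0)) i * e i x)"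
          using k psubset.hyps by (auto simp: sum.remove[of I k] intro!: sum.cong)
      qed
      ultimately have "spans (I - {k}) e V"
        using psubset.prems unfolding spans_def by (simp, blast)
      moreover have "I - {k} \<subset> I" using k by blast
      ultimately show ?thesis using psubset.IH[of "I - {k}"] by blast
    qed (use psubset in blast)
  qed
qed

lemma spans_finite_dim_space: "finite_dim_space V \<Longrightarrow> \<exists>B. spans B (\<lambda>b. b) V"
  by (auto simp: finite_dim_space_def spans_def)

lemma spans_ball_iff:
  assumes "spans I e V" and F: "\<And>c. F (\<lambda>x. \<Sum>i\<in>I. c i * e i x) = (\<Sum>i\<in>I. c i * F (e i))"
  shows "(\<forall>v\<in>V. F v = (0::real)) \<longleftrightarrow> (\<forall>i\<in>I. F (e i) = 0)"
proof
  show "\<forall>v\<in>V. F v = 0 \<Longrightarrow> \<forall>i\<in>I. F (e i) = 0"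
    using spans_basis_mem[OF assms(1)] by blast
  show "\<forall>i\<in>I. F (e i) = 0 \<Longrightarrow> \<forall>v\<in>V. F v = 0"
    using assms(1) F by (auto simp: spans_def)
qed

section \<open>Trigonometric polynomials on the circle\<close>

lemma circ_pt_nth [simp]: "circ_pt r \<theta> $ 1 = r * cos \<theta>" "circ_pt r \<theta> $ 2 = r * sin \<theta>"
  by (simp_all add: circ_pt_def)

lemma sphere_eq_circ_pt:
  assumes "r > 0"
  shows "sphere 0 r = range (circ_pt r)"
proof
  show "range (circ_pt r) \<subseteq> sphere 0 r"
  proof
    fix x assume "x \<in> range (circ_pt r)"
    then obtain \<theta> where x: "x = circ_pt r \<theta>" by blast
    have "(r * cos \<theta>)\<^sup>2 + (r * sin \<theta>)\<^sup>2 = r\<^sup>2"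
      by (simp add: power_mult_distrib flip: distrib_left)
    then show "x \<in> sphere 0 r"
      using assms by (simp add: x norm_eq_sqrt_inner inner_vec_def UNIV_2 power2_eq_square)
  qed
  show "sphere 0 r \<subseteq> range (circ_pt r)"
  proof
    fix x :: "real^2" assume "x \<in> sphere 0 r"
    then have "x \<bullet> x = r\<^sup>2"
      by (simp flip: power2_norm_eq_inner)
    then have "(x$1)\<^sup>2 + (x$2)\<^sup>2 = r\<^sup>2"
      by (simp add: inner_vec_def UNIV_2 power2_eq_square)
    then have "(x$1 / r)\<^sup>2 + (x$2 / r)\<^sup>2 = 1"
      using assms by (simp add: power_divide flip: add_divide_distrib)
    then obtain t where "x$1 / r = cos t" "x$2 / r = sin t"
      using sincos_total_2pi by metis
    then have "x = circ_pt r t"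
      using assms by (auto simp: vec_eq_iff forall_2 field_simps)
    then show "x \<in> range (circ_pt r)" by blast
  qed
qed

lemma rot_circ_pt: "rot t (circ_pt r \<theta>) = circ_pt r (\<theta> + t)"
  by (auto simp: rot_def vec_eq_iff forall_2 cos_add sin_add algebra_simps)

lemma circ_pt_periodic [simp]: "circ_pt r (\<theta> + 2 * pi) = circ_pt r \<theta>"
  by (simp add: vec_eq_iff forall_2)

definition trig_val :: "nat + nat \<Rightarrow> real \<Rightarrow> real" where
  "trig_val k \<theta> = (case k of Inl n \<Rightarrow> cos (real n * \<theta>) | Inr n \<Rightarrow> sin (real n * \<theta>))"

text \<open>Powers of \<open>cis \<theta>\<close> give functions of the point \<open>circ_pt r \<theta>\<close> without a choice of angle.\<close>

definition trig_fn :: "real \<Rightarrow> nat + nat \<Rightarrow> real^2 \<Rightarrow> real" where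
  "trig_fn r k x = (let z = Complex (x$1 / r) (x$2 / r) in
    if x \<notin> sphere 0 r then 0 else case k of Inl n \<Rightarrow> Re (z ^ n) | Inr n \<Rightarrow> Im (z ^ n))"

lemma trig_fn_circ_pt:
  assumes "r > 0"
  shows "trig_fn r k (circ_pt r \<theta>) = trig_val k \<theta>"
proof -
  have "Complex (circ_pt r \<theta> $ 1 / r) (circ_pt r \<theta> $ 2 / r) = cis \<theta>"
    using assms by (simp add: complex_eq_iff)
  moreover have "circ_pt r \<theta> \<in> sphere 0 r"
    using sphere_eq_circ_pt[OF assms] by blast
  ultimately show ?thesis
    by (simp add: trig_fn_def trig_val_def Complex.DeMoivre del: mem_sphere_0 split: sum.split)
qed

lemma trig_fn_outside: "x \<notin> sphere 0 r \<Longrightarrow> trig_fn r k x = 0"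
  by (simp add: trig_fn_def)

text \<open>The constant term enters the trigonometric space halved, hence the correction of the coefficient
  of index \<open>0\<close> in both directions.\<close>

lemma spans_trig_space:
  assumes r: "r > 0"
  shows "spans ({..N} <+> {1..N}) (trig_fn r) (trig_space r N)"
  unfolding spans_def
proof (intro conjI set_eqI iffI)
  show "finite ({..N} <+> {1..N})" by simp
  have split: "(\<Sum>k\<in>{..N} <+> {1..N}. c k * trig_val k \<theta>) =
      c (Inl 0) + (\<Sum>n=1..N. c (Inl n) * cos (real n * \<theta>) + c (Inr n) * sin (real n * \<theta>))" for c \<theta>
  proof -
    have "{..N} = insert 0 {1..N}" by auto
    then show ?thesis
      by (simp add: sum.Plus trig_val_def sum.distrib)
  qed
  {
    fix \<mu> assume "\<mu> \<in> trig_space r N"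
    then obtain c d where \<mu>: "\<And>\<theta>. \<mu> (circ_pt r \<theta>) = c 0 / 2 +
        (\<Sum>n=1..N. c n * cos (real n * \<theta>) + d n * sin (real n * \<theta>))" "\<And>x. x \<notin> sphere 0 r \<Longrightarrow> \<mu> x = 0"
      unfolding trig_space_def by blast
    define c' where "c' = case_sum (c(0 := c 0 / 2)) d"
    have "\<mu> = (\<lambda>x. \<Sum>k\<in>{..N} <+> {1..N}. c' k * trig_fn r k x)"
    proof
      fix x
      show "\<mu> x = (\<Sum>k\<in>{..N} <+> {1..N}. c' k * trig_fn r k x)"
      proof (cases "x \<in> sphere 0 r")
        case True
        then obtain \<theta> where x: "x = circ_pt r \<theta>" using sphere_eq_circ_pt[OF r] by blast
        show ?thesis
          unfolding x trig_fn_circ_pt[OF r] split \<mu>(1) c'_def by (auto intro!: sum.cong)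
      qed (simp add: \<mu>(2) trig_fn_outside del: mem_sphere_0)
    qed
    then show "\<mu> \<in> {(\<lambda>x. \<Sum>k\<in>{..N} <+> {1..N}. c k * trig_fn r k x) | c. True}" by blast
  next
    fix \<mu> assume "\<mu> \<in> {(\<lambda>x. \<Sum>k\<in>{..N} <+> {1..N}. c k * trig_fn r k x) | c. True}"
    then obtain c where \<mu>: "\<mu> = (\<lambda>x. \<Sum>k\<in>{..N} <+> {1..N}. c k * trig_fn r k x)" by blast
    define c0 where "c0 = (\<lambda>n. c (Inl n))(0 := 2 * c (Inl 0))"
    have "\<mu> (circ_pt r \<theta>) = c0 0 / 2 +
        (\<Sum>n=1..N. c0 n * cos (real n * \<theta>) + c (Inr n) * sin (real n * \<theta>))" for \<theta>
      unfolding \<mu> trig_fn_circ_pt[OF r] split by (auto simp: c0_def intro!: sum.cong)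
    then have "\<exists>c d. \<forall>\<theta>. \<mu> (circ_pt r \<theta>) = c 0 / 2 +
        (\<Sum>n=1..N. c n * cos (real n * \<theta>) + d n * sin (real n * \<theta>))"
      by (intro exI[of _ c0] exI[of _ "\<lambda>n. c (Inr n)"]) blast
    moreover have "\<mu> x = 0" if "x \<notin> sphere 0 r" for x
      unfolding \<mu> using trig_fn_outside[OF that] by simp
    ultimately show "\<mu> \<in> trig_space r N"
      unfolding trig_space_def by blast
  }
qed

section \<open>Pairings with rotated functions\<close>

lemma periodic_int:
  fixes F :: "real \<Rightarrow> 'a"
  assumes per: "\<And>x. F (x + p) = F x"
  shows "F (x + of_int k * p) = F x"
proof (induction k rule: int_induct[where k = 0])
  case (step1 i)
  then show ?case using per[of "x + of_int i * p"] by (simp add: algebra_simps)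
next
  case (step2 i)
  then show ?case using per[of "x + of_int (i - 1) * p"] by (simp add: algebra_simps)
qed simp

lemma has_integral_periodic_shift:
  fixes F :: "real \<Rightarrow> real"
  assumes per: "\<And>x. F (x + p) = F x" and p: "p > 0" and F: "(F has_integral I) {0..p}"
  shows "((\<lambda>x. F (x + s)) has_integral I) {0..p}"
proof -
  define t where "t = s - of_int \<lfloor>s / p\<rfloor> * p"
  have t: "0 \<le> t" "t \<le> p"
    using p floor_divide_lower[OF p, of s] floor_divide_upper[OF p, of s]
    by (auto simp: t_def algebra_simps)
  have "F integrable_on {0..t}" "F integrable_on {t..p}"
    using t integrable_subinterval_real[OF has_integral_integrable[OF F]] by auto
  then obtain J1 J2 where J: "(F has_integral J1) {0..t}" "(F has_integral J2) {t..p}"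
    by (auto simp: integrable_on_def)
  have I: "I = J1 + J2"
    using has_integral_combine[OF t J] F by (rule has_integral_unique[rotated])
  have "F (x - p) = F x" for x
    using per[of "x - p"] by simp
  then have "(F has_integral J1) {p..t + p}"
    using has_integral_shift_real_ivl[OF J(1), of "-p"] by simp
  then have "(F has_integral I) {t..t + p}"
    using has_integral_combine[OF _ _ J(2)] t I by (simp add: add.commute)
  then have "((\<lambda>x. F (x + t)) has_integral I) {0..p}"
    using has_integral_shift_real_ivl[of F I t "t + p" t] by simp
  moreover have "F (x + s) = F (x + t)" for x
    using periodic_int[of F p "x + t" "\<lfloor>s / p\<rfloor>", OF per] by (simp add: t_def algebra_simps)
  ultimately show ?thesis by simp
qed

lemma integrable_periodic_shift:
  fixes F :: "real \<Rightarrow> real"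
  assumes per: "\<And>x. F (x + p) = F x" and p: "p > 0" and F: "integrable (lebesgue_on {0..p}) F"
  shows "integrable (lebesgue_on {0..p}) (\<lambda>x. F (x + s))"
    and "(LINT x|lebesgue_on {0..p}. F (x + s)) = (LINT x|lebesgue_on {0..p}. F x)"
proof -
  have F': "F integrable_on {0..p}" "(\<lambda>x. \<bar>F x\<bar>) integrable_on {0..p}"
    using F integrable_on_lebesgue_on[of "{0..p}"] by auto
  then have "(\<lambda>x. F (x + s)) integrable_on {0..p}" "(\<lambda>x. \<bar>F (x + s)\<bar>) integrable_on {0..p}"
    using has_integral_periodic_shift[of F p _ s, OF per p]
      has_integral_periodic_shift[of "\<lambda>x. \<bar>F x\<bar>" p _ s, OF _ p] per
    unfolding integrable_on_def by auto
  then show int: "integrable (lebesgue_on {0..p}) (\<lambda>x. F (x + s))"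
    by (intro absolutely_integrable_imp_integrable absolutely_integrable_onI) auto
  have "integral {0..p} (\<lambda>x. F (x + s)) = integral {0..p} F"
    using has_integral_periodic_shift[OF per p integrable_integral[OF F'(1)]] by (rule integral_unique)
  then show "(LINT x|lebesgue_on {0..p}. F (x + s)) = (LINT x|lebesgue_on {0..p}. F x)"
    using int F by (simp add: lebesgue_integral_eq_integral)
qed

definition circ_integrable :: "real \<Rightarrow> (real^2 \<Rightarrow> real) \<Rightarrow> bool" where
  "circ_integrable r w \<longleftrightarrow> integrable (lebesgue_on {0..2*pi}) (\<lambda>\<theta>. w (circ_pt r \<theta>))"

lemma circ_integrable_rot:
  assumes "circ_integrable r w"
  shows "circ_integrable r (w \<circ> rot t)"
  using integrable_periodic_shift(1)[of "\<lambda>\<theta>. w (circ_pt r \<theta>)" "2 * pi" t] assms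
  by (simp add: circ_integrable_def rot_circ_pt)

lemma trig_val_bound: "\<bar>trig_val k \<theta>\<bar> \<le> 1"
  by (simp add: trig_val_def split: sum.split)

lemma trig_val_integrable_mult:
  assumes "integrable (lebesgue_on {0..2*pi}) f"
  shows "integrable (lebesgue_on {0..2*pi}) (\<lambda>\<theta>. trig_val k (\<theta> + s) * f \<theta>)"
proof (rule Bochner_Integration.integrable_bound[OF assms])
  have "continuous_on {0..2*pi} (\<lambda>\<theta>. trig_val k (\<theta> + s))"
    by (cases k) (auto simp: trig_val_def intro!: continuous_intros)
  then have "(\<lambda>\<theta>. trig_val k (\<theta> + s)) \<in> borel_measurable (lebesgue_on {0..2*pi})"
    by (intro continuous_imp_measurable_on_sets_lebesgue) auto
  then show "(\<lambda>\<theta>. trig_val k (\<theta> + s) * f \<theta>) \<in> borel_measurable (lebesgue_on {0..2*pi})"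
    using assms by (intro borel_measurable_times) auto
  show "AE \<theta> in lebesgue_on {0..2*pi}. norm (trig_val k (\<theta> + s) * f \<theta>) \<le> norm (f \<theta>)"
    using trig_val_bound by (intro AE_I2) (simp add: abs_mult mult_left_le_one_le)
qed

lemma trig_fn_integrable:
  assumes "r > 0" "circ_integrable r w"
  shows "integrable (lebesgue_on {0..2*pi}) (\<lambda>\<theta>. trig_fn r k (circ_pt r \<theta>) * w (circ_pt r \<theta>) * r)"
  using trig_val_integrable_mult[of "\<lambda>\<theta>. w (circ_pt r \<theta>)" k 0] assms
  by (simp add: trig_fn_circ_pt circ_integrable_def)

lemma circ_inner_commute: "circ_inner r f g = circ_inner r g f"
  by (simp add: circ_inner_def mult.commute)

lemma circ_inner_sum_left:
  assumes "r > 0" "circ_integrable r w"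
  shows "circ_inner r (\<lambda>x. \<Sum>k\<in>K. l k * trig_fn r k x) w = (\<Sum>k\<in>K. l k * circ_inner r (trig_fn r k) w)"
  using trig_fn_integrable[OF assms]
  unfolding circ_inner_def sum_distrib_right mult.assoc
  by (subst Bochner_Integration.integral_sum) auto

lemma circ_inner_sum_right:
  assumes "r > 0" "\<And>j. j \<in> J \<Longrightarrow> circ_integrable r (w j)"
  shows "circ_inner r (trig_fn r k) (\<lambda>x. \<Sum>j\<in>J. c j * w j x) = (\<Sum>j\<in>J. c j * circ_inner r (trig_fn r k) (w j))"
proof -
  have "trig_fn r k x * (\<Sum>j\<in>J. c j * w j x) * r = (\<Sum>j\<in>J. c j * (trig_fn r k x * w j x * r))" for x
    by (simp add: sum_distrib_left sum_distrib_right mult_ac)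
  then show ?thesis
    using trig_fn_integrable[OF assms(1) assms(2)] unfolding circ_inner_def
    by (simp add: Bochner_Integration.integral_sum)
qed

text \<open>The dependence on \<open>\<alpha>\<close> is shifted from \<open>w\<close>, which is merely integrable, to the trigonometric
  factor, where the addition theorems separate \<open>\<alpha>\<close> from \<open>\<theta>\<close>.\<close>

lemma smooth_circ_inner_rot:
  assumes r: "r > 0" and w: "circ_integrable r w"
  shows "infinitely_differentiable (\<lambda>\<alpha>. circ_inner r (trig_fn r k) (w \<circ> rot (- \<alpha>)))"
proof -
  let ?L = "lebesgue_on {0..2 * pi}" and ?w = "\<lambda>\<theta>. w (circ_pt r \<theta>)"
  have int: "integrable ?L (\<lambda>\<theta>. trig_val k (\<theta> + s) * ?w \<theta>)" for k s
    using trig_val_integrable_mult w by (simp add: circ_integrable_def)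
  have int0: "integrable ?L (\<lambda>\<theta>. trig_val k \<theta> * ?w \<theta>)" for k
    using int[of k 0] by simp
  have shift: "circ_inner r (trig_fn r k) (w \<circ> rot (- \<alpha>)) =
      (LINT \<theta>|?L. trig_val k (\<theta> + \<alpha>) * ?w \<theta> * r)" for k \<alpha>
  proof -
    have "trig_val k (x + 2 * pi) = trig_val k x" for x
      by (metis circ_pt_periodic trig_fn_circ_pt[OF r])
    then have "trig_val k (\<theta> + 2 * pi + \<alpha>) = trig_val k (\<theta> + \<alpha>)" for \<theta>
      by (metis add.assoc add.commute)
    then show ?thesis
      using integrable_periodic_shift(2)[of "\<lambda>\<theta>. trig_val k (\<theta> + \<alpha>) * ?w \<theta> * r" "2 * pi" "- \<alpha>"]
        int[of k \<alpha>] by (simp add: circ_inner_def rot_circ_pt trig_fn_circ_pt[OF r])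
  qed
  define C where "C n = (LINT \<theta>|?L. trig_val (Inl n) \<theta> * ?w \<theta> * r)" for n
  define S where "S n = (LINT \<theta>|?L. trig_val (Inr n) \<theta> * ?w \<theta> * r)" for n
  show ?thesis
  proof (cases k)
    case (Inl n)
    have "trig_val k (\<theta> + \<alpha>) * ?w \<theta> * r = cos (real n * \<alpha>) * (trig_val (Inl n) \<theta> * ?w \<theta> * r) -
        sin (real n * \<alpha>) * (trig_val (Inr n) \<theta> * ?w \<theta> * r)" for \<theta> \<alpha>
      by (simp add: Inl trig_val_def distrib_left cos_add algebra_simps)
    then have "circ_inner r (trig_fn r k) (w \<circ> rot (- \<alpha>)) =
        cos (real n * \<alpha>) * C n - sin (real n * \<alpha>) * S n" for \<alpha>
      unfolding shift C_def S_def using int0 by simp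
    then show ?thesis by (simp add: smooth_intros)
  next
    case (Inr n)
    have "trig_val k (\<theta> + \<alpha>) * ?w \<theta> * r = cos (real n * \<alpha>) * (trig_val (Inr n) \<theta> * ?w \<theta> * r) +
        sin (real n * \<alpha>) * (trig_val (Inl n) \<theta> * ?w \<theta> * r)" for \<theta> \<alpha>
      by (simp add: Inr trig_val_def distrib_left sin_add algebra_simps)
    then have "circ_inner r (trig_fn r k) (w \<circ> rot (- \<alpha>)) =
        cos (real n * \<alpha>) * S n + sin (real n * \<alpha>) * C n" for \<alpha>
      unfolding shift C_def S_def using int0 by simp
    then show ?thesis by (simp add: smooth_intros)
  qed
qed

lemma circ_pt_eq_axis: "circ_pt r = (\<lambda>\<theta>. (r * cos \<theta>) *\<^sub>R axis 1 1 + (r * sin \<theta>) *\<^sub>R axis 2 1)"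
  by (simp add: fun_eq_iff vec_eq_iff forall_2 axis_def)

lemma continuous_on_circ_pt: "continuous_on A (circ_pt r)"
  unfolding circ_pt_eq_axis by (intro continuous_intros)

lemma circ_integrable_sum:
  assumes "\<And>j. j \<in> J \<Longrightarrow> circ_integrable r (w j)"
  shows "circ_integrable r (\<lambda>x. \<Sum>j\<in>J. c j * w j x)"
  using assms unfolding circ_integrable_def by (intro Bochner_Integration.integrable_sum integrable_mult_right)

lemma circ_integrable_diff:
  "circ_integrable r v \<Longrightarrow> circ_integrable r w \<Longrightarrow> circ_integrable r (\<lambda>x. v x - w x)"
  unfolding circ_integrable_def by (rule Bochner_Integration.integrable_diff)

lemma circ_integrable_continuous:
  assumes "continuous_on (sphere 0 r) v" "r > 0"
  shows "circ_integrable r v"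
proof -
  have "continuous_on {0..2*pi} (\<lambda>\<theta>. v (circ_pt r \<theta>))"
    using sphere_eq_circ_pt[OF assms(2)]
    by (intro continuous_on_compose2[OF assms(1) continuous_on_circ_pt]) auto
  then show ?thesis
    unfolding circ_integrable_def
    by (intro absolutely_integrable_imp_integrable absolutely_integrable_continuous_real) auto
qed

lemma circ_inner_trig_diff:
  assumes "r > 0" "circ_integrable r v" "circ_integrable r w"
  shows "circ_inner r (trig_fn r k) (\<lambda>x. v x - w x) = circ_inner r (trig_fn r k) v - circ_inner r (trig_fn r k) w"
  using trig_fn_integrable[OF assms(1,2)] trig_fn_integrable[OF assms(1,3)]
  unfolding circ_inner_def by (simp add: right_diff_distrib left_diff_distrib)

lemma circ_inner_trig_sum_right:
  assumes r: "r > 0" and w: "\<And>j. j \<in> J \<Longrightarrow> circ_integrable r (w j)"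
  shows "circ_inner r (\<lambda>x. \<Sum>k\<in>K. l k * trig_fn r k x) (\<lambda>x. \<Sum>j\<in>J. c j * w j x) =
    (\<Sum>j\<in>J. c j * circ_inner r (\<lambda>x. \<Sum>k\<in>K. l k * trig_fn r k x) (w j))"
proof -
  have "circ_inner r (\<lambda>x. \<Sum>k\<in>K. l k * trig_fn r k x) (\<lambda>x. \<Sum>j\<in>J. c j * w j x) =
      (\<Sum>k\<in>K. \<Sum>j\<in>J. c j * (l k * circ_inner r (trig_fn r k) (w j)))"
    by (simp add: circ_inner_sum_left circ_inner_sum_right circ_integrable_sum r w
        sum_distrib_left mult.left_commute)
  also have "\<dots> = (\<Sum>j\<in>J. c j * circ_inner r (\<lambda>x. \<Sum>k\<in>K. l k * trig_fn r k x) (w j))"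
    by (subst sum.swap) (simp add: circ_inner_sum_left r w sum_distrib_left)
  finally show ?thesis .
qed

lemma sum_rot: "(\<lambda>x. \<Sum>j\<in>J. c j * w j x) \<circ> rot t = (\<lambda>x. \<Sum>j\<in>J. c j * (w j \<circ> rot t) x)"
  by (simp add: o_def)

lemma circ_inner_cong_countable:
  assumes r: "r > 0" and w: "circ_integrable r w" "circ_integrable r w'"
    and E: "countable E" "\<And>\<theta>. \<theta> \<notin> E \<Longrightarrow> w (circ_pt r \<theta>) = w' (circ_pt r \<theta>)"
  shows "circ_inner r (trig_fn r k) (w \<circ> rot t) = circ_inner r (trig_fn r k) (w' \<circ> rot t)"
proof -
  let ?E = "(\<lambda>\<theta>. \<theta> - t) ` E"
  have "?E \<in> null_sets lebesgue"
    using E(1) countable_imp_null_set_lborel[of ?E] null_sets_completionI by auto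
  then have "AE \<theta> in lebesgue. \<theta> \<notin> ?E" by (rule AE_not_in)
  then have ae: "AE \<theta> in lebesgue_on {0..2*pi}. \<theta> \<notin> ?E"
    by (auto simp: AE_restrict_space_iff elim: eventually_mono)
  have eq: "w (circ_pt r (\<theta> + t)) = w' (circ_pt r (\<theta> + t))" if "\<theta> \<notin> ?E" for \<theta>
    using that E(2)[of "\<theta> + t"] by (force simp: image_iff)
  show ?thesis
    unfolding circ_inner_def
  proof (rule integral_cong_AE)
    show "AE \<theta> in lebesgue_on {0..2*pi}.
        trig_fn r k (circ_pt r \<theta>) * (w \<circ> rot t) (circ_pt r \<theta>) * r =
        trig_fn r k (circ_pt r \<theta>) * (w' \<circ> rot t) (circ_pt r \<theta>) * r"
      using ae by eventually_elim (simp add: rot_circ_pt eq)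
  qed (use trig_fn_integrable[OF r circ_integrable_rot] w in blast)+
qed

section \<open>The angular derivative of piecewise smooth functions\<close>

text \<open>Each isolated point is cut out of \<open>S\<close> by a member of a countable basis.\<close>

lemma countable_non_islimpt:
  fixes S :: "'a::second_countable_topology set"
  shows "countable {x\<in>S. \<not> x islimpt S}"
proof -
  obtain \<B> :: "'a set set" where \<B>: "countable \<B>" "topological_basis \<B>"
    using ex_countable_basis by blast
  have "\<exists>B\<in>\<B>. B \<inter> S = {x}" if x: "x \<in> S" "\<not> x islimpt S" for x
  proof -
    obtain T where T: "x \<in> T" "open T" "\<forall>y\<in>S. y \<in> T \<longrightarrow> y = x"
      using x(2) unfolding islimpt_def by blast
    obtain B where B: "B \<in> \<B>" "x \<in> B" "B \<subseteq> T"
      by (rule topological_basisE[OF \<B>(2) T(2,1)])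
    then have "B \<inter> S = {x}" using T x(1) by blast
    then show ?thesis using B(1) by blast
  qed
  then obtain B where B: "\<And>x. x \<in> {x\<in>S. \<not> x islimpt S} \<Longrightarrow> B x \<in> \<B> \<and> B x \<inter> S = {x}"
    by (metis (mono_tags, lifting) mem_Collect_eq)
  then have inj: "inj_on B {x\<in>S. \<not> x islimpt S}"
    by (metis (no_types, lifting) inj_onI singleton_inject)
  have "B ` {x\<in>S. \<not> x islimpt S} \<subseteq> \<B>"
    using B by blast
  then show ?thesis
    by (rule countable_image_inj_on[OF countable_subset[OF _ \<B>(1)] inj])
qed

lemma DERIV_within_finite_closed_cover:
  fixes u :: "real \<Rightarrow> real"
  assumes "finite \<C>" and "\<And>C. C \<in> \<C> \<Longrightarrow> closed C"
    and "\<And>C. C \<in> \<C> \<Longrightarrow> \<theta> \<in> C \<Longrightarrow> (u has_real_derivative d) (at \<theta> within C)"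
  shows "(u has_real_derivative d) (at \<theta> within \<Union>\<C>)"
  using assms
proof (induction \<C> rule: finite_induct)
  case empty
  show ?case by (simp add: has_field_derivative_iff)
next
  case (insert C \<C>)
  have "(u has_real_derivative d) (at \<theta> within C)"
  proof (cases "\<theta> \<in> C")
    case False
    then have "at \<theta> within C = bot"
      using insert.prems(1)[of C] closed_limpt[of C] unfolding trivial_limit_within by blast
    then show ?thesis by (simp add: has_field_derivative_iff)
  qed (use insert.prems in simp)
  moreover have "(u has_real_derivative d) (at \<theta> within \<Union>\<C>)"
    using insert by simp
  ultimately show ?case
    by (simp add: has_field_derivative_iff Lim_Un)
qed

text \<open>If \<open>\<theta>\<close> is a limit point of \<open>C K \<inter> C L\<close>, then the two pieces agree along a sequence tending to
  \<open>\<theta>\<close>, so they have the same derivative there. What remains are isolated points of pairwise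
  intersections.\<close>

lemma piecewise_differentiable:
  fixes u :: "real \<Rightarrow> real" and f f' :: "'k \<Rightarrow> real \<Rightarrow> real"
  assumes T: "finite T" "\<And>K. K \<in> T \<Longrightarrow> closed (C K)" "(\<Union>K\<in>T. C K) = UNIV"
    and u: "\<And>K \<theta>. K \<in> T \<Longrightarrow> \<theta> \<in> C K \<Longrightarrow> u \<theta> = f K \<theta>"
    and f: "\<And>K \<theta>. K \<in> T \<Longrightarrow> \<theta> \<in> C K \<Longrightarrow> (f K has_real_derivative f' K \<theta>) (at \<theta>)"
  shows "\<exists>E. countable E \<and> (\<forall>\<theta>. \<theta> \<notin> E \<longrightarrow>
    (\<exists>K\<in>T. \<theta> \<in> C K \<and> (u has_real_derivative f' K \<theta>) (at \<theta>)))"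
proof (intro exI conjI allI impI)
  let ?E = "\<Union>K\<in>T. \<Union>L\<in>T. {\<theta> \<in> C K \<inter> C L. \<not> \<theta> islimpt (C K \<inter> C L)}"
  show "countable ?E"
    using T(1) by (intro countable_UN countable_finite countable_non_islimpt)
  have u_within: "(u has_real_derivative f' K \<theta>) (at \<theta> within C K)" if "K \<in> T" "\<theta> \<in> C K" for K \<theta>
    by (rule has_field_derivative_transform_within[OF has_field_derivative_at_within[OF f[OF that]], of 1])
      (use u that in auto)
  fix \<theta> assume \<theta>: "\<theta> \<notin> ?E"
  obtain K where K: "K \<in> T" "\<theta> \<in> C K" using T(3) by blast
  have same: "f' L \<theta> = f' K \<theta>" if L: "L \<in> T" "\<theta> \<in> C L" for L
  proof -
    have "\<theta> islimpt (C K \<inter> C L)" using \<theta> K L by blast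
    then have "at \<theta> within (C K \<inter> C L) \<noteq> bot" by (simp add: trivial_limit_within)
    moreover have "(u has_real_derivative f' L \<theta>) (at \<theta> within (C K \<inter> C L))"
      "(u has_real_derivative f' K \<theta>) (at \<theta> within (C K \<inter> C L))"
      using u_within[OF L] u_within[OF K] by (auto intro: DERIV_subset)
    ultimately show ?thesis
      unfolding has_field_derivative_iff using tendsto_unique by blast
  qed
  have "(u has_real_derivative f' K \<theta>) (at \<theta> within \<Union>(C ` T))"
    using T(1,2) u_within same by (intro DERIV_within_finite_closed_cover) fastforce+
  then show "\<exists>K\<in>T. \<theta> \<in> C K \<and> (u has_real_derivative f' K \<theta>) (at \<theta>)"
    using K T(3) by auto
qed

lemma DERIV_smooth_circ_pt:
  assumes f: "smooth_on U f" and x: "circ_pt r \<theta> \<in> U"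
  shows "((\<lambda>\<theta>. f (circ_pt r \<theta>)) has_real_derivative
    r * (cos \<theta> * partial_deriv 2 f (circ_pt r \<theta>) - sin \<theta> * partial_deriv 1 f (circ_pt r \<theta>))) (at \<theta>)"
proof -
  let ?x = "circ_pt r \<theta>" and ?v = "(- r * sin \<theta>) *\<^sub>R axis 1 1 + (r * cos \<theta>) *\<^sub>R axis 2 (1::real) :: real^2"
  have "f differentiable_on U" "open U"
    using f by (auto simp: smooth_on_def dest: spec[of _ "Suc 0"])
  then have "f differentiable (at ?x)"
    using x by (simp add: differentiable_on_eq_differentiable_at)
  then have df: "(f has_derivative frechet_derivative f (at ?x)) (at ?x)"
    by (simp add: frechet_derivative_works)
  have "(circ_pt r has_vector_derivative ?v) (at \<theta>)"
    unfolding circ_pt_eq_axis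
  proof (rule has_vector_derivative_add[THEN has_vector_derivative_eq_rhs])
    show "((\<lambda>\<theta>. (r * cos \<theta>) *\<^sub>R axis 1 1 :: real^2) has_vector_derivative
        (r * cos \<theta>) *\<^sub>R 0 + (- r * sin \<theta>) *\<^sub>R axis 1 1) (at \<theta>)"
      by (rule has_vector_derivative_scaleR) (auto intro!: derivative_eq_intros)
    show "((\<lambda>\<theta>. (r * sin \<theta>) *\<^sub>R axis 2 1 :: real^2) has_vector_derivative
        (r * sin \<theta>) *\<^sub>R 0 + (r * cos \<theta>) *\<^sub>R axis 2 1) (at \<theta>)"
      by (rule has_vector_derivative_scaleR) (auto intro!: derivative_eq_intros)
  qed simp
  then have "((\<lambda>\<theta>. f (circ_pt r \<theta>)) has_derivative (\<lambda>t. frechet_derivative f (at ?x) (t *\<^sub>R ?v))) (at \<theta>)"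
    using has_derivative_compose[of "circ_pt r" _ \<theta> UNIV f, OF _ df] by (simp add: has_vector_derivative_def)
  moreover have "frechet_derivative f (at ?x) (t *\<^sub>R ?v) =
      r * (cos \<theta> * partial_deriv 2 f ?x - sin \<theta> * partial_deriv 1 f ?x) * t" for t
  proof -
    interpret linear "frechet_derivative f (at ?x)"
      using df has_derivative_linear by blast
    show ?thesis
      by (simp only: scale add partial_deriv_def) (simp add: algebra_simps)
  qed
  ultimately show ?thesis by (simp add: has_field_derivative_def)
qed

lemma piecewise_smooth_circle:
  assumes \<T>: "finite \<T>" "\<And>K. K \<in> \<T> \<Longrightarrow> compact K" and cover: "sphere 0 r \<subseteq> \<Union>\<T>" and r: "r > 0"
    and v: "piecewise_smooth \<T> v"
  obtains E B where "countable E"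
    "\<And>\<theta>. \<theta> \<notin> E \<Longrightarrow> \<exists>d. ((\<lambda>\<theta>. v (circ_pt r \<theta>)) has_real_derivative d) (at \<theta>) \<and> \<bar>d\<bar> \<le> B"
proof -
  obtain U f where f: "\<And>K. K \<in> \<T> \<Longrightarrow> K \<subseteq> U K \<and> smooth_on (U K) (f K) \<and> (\<forall>x\<in>K. v x = f K x)"
    using v unfolding piecewise_smooth_def by metis
  have cover': "\<exists>K\<in>\<T>. circ_pt r \<theta> \<in> K" for \<theta>
    using cover sphere_eq_circ_pt[OF r] by blast
  have "\<exists>B. \<forall>K\<in>\<T>. \<forall>x\<in>K. \<bar>partial_deriv i (f K) x\<bar> \<le> B" for i
  proof -
    have "\<exists>B. \<forall>x\<in>K. \<bar>partial_deriv i (f K) x\<bar> \<le> B" if K: "K \<in> \<T>" for K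
    proof -
      have "continuous_on (U K) (partial_deriv i (f K))"
        using f[OF K] by (auto simp: smooth_on_def dest: spec[of _ "Suc 0"])
      then have "bounded (partial_deriv i (f K) ` K)"
        using f[OF K] \<T>(2)[OF K]
        by (intro compact_imp_bounded compact_continuous_image) (auto intro: continuous_on_subset)
      then show ?thesis by (auto simp: bounded_iff)
    qed
    then obtain B where B: "\<And>K x. K \<in> \<T> \<Longrightarrow> x \<in> K \<Longrightarrow> \<bar>partial_deriv i (f K) x\<bar> \<le> B K"
      by metis
    show ?thesis
    proof (intro exI[of _ "Max (B ` \<T>)"] ballI)
      fix K x assume "K \<in> \<T>" "x \<in> K"
      then show "\<bar>partial_deriv i (f K) x\<bar> \<le> Max (B ` \<T>)"
        using B[of K x] \<T>(1) by (intro order_trans[OF _ Max_ge[of _ "B K"]]) simp_all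
    qed
  qed
  then obtain B where B: "\<And>i K x. K \<in> \<T> \<Longrightarrow> x \<in> K \<Longrightarrow> \<bar>partial_deriv i (f K) x\<bar> \<le> B i"
    by metis
  define f' where "f' = (\<lambda>K \<theta>. r * (cos \<theta> * partial_deriv 2 (f K) (circ_pt r \<theta>) -
    sin \<theta> * partial_deriv 1 (f K) (circ_pt r \<theta>)))"
  have f'_bound: "\<bar>f' K \<theta>\<bar> \<le> r * (B 2 + B 1)" if K: "K \<in> \<T>" "circ_pt r \<theta> \<in> K" for K \<theta>
  proof -
    let ?p = "\<lambda>i. partial_deriv i (f K) (circ_pt r \<theta>)"
    have "\<bar>cos \<theta> * ?p 2 - sin \<theta> * ?p 1\<bar> \<le> \<bar>cos \<theta>\<bar> * \<bar>?p 2\<bar> + \<bar>sin \<theta>\<bar> * \<bar>?p 1\<bar>"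
      using abs_triangle_ineq4[of "cos \<theta> * ?p 2" "sin \<theta> * ?p 1"] by (simp add: abs_mult)
    also have "\<dots> \<le> 1 * B 2 + 1 * B 1"
      using B[OF K] by (intro add_mono mult_mono) auto
    finally show ?thesis using r by (simp add: f'_def abs_mult)
  qed
  have "\<exists>E. countable E \<and> (\<forall>\<theta>. \<theta> \<notin> E \<longrightarrow> (\<exists>K\<in>\<T>. \<theta> \<in> circ_pt r -` K \<and>
      ((\<lambda>\<theta>. v (circ_pt r \<theta>)) has_real_derivative f' K \<theta>) (at \<theta>)))"
  proof (rule piecewise_differentiable[OF \<T>(1), where f = "\<lambda>K \<theta>. f K (circ_pt r \<theta>)"])
    show "closed (circ_pt r -` K)" if "K \<in> \<T>" for K
      using \<T>(2)[OF that] by (intro closed_vimage compact_imp_closed continuous_on_circ_pt)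
    show "(\<Union>K\<in>\<T>. circ_pt r -` K) = UNIV" using cover' by blast
    show "v (circ_pt r \<theta>) = f K (circ_pt r \<theta>)" if "K \<in> \<T>" "\<theta> \<in> circ_pt r -` K" for K \<theta>
      using f that by auto
    show "((\<lambda>\<theta>. f K (circ_pt r \<theta>)) has_real_derivative f' K \<theta>) (at \<theta>)"
      if "K \<in> \<T>" "\<theta> \<in> circ_pt r -` K" for K \<theta>
      unfolding f'_def using f[OF that(1)] that(2) by (intro DERIV_smooth_circ_pt[of "U K"]) auto
  qed
  then show thesis using that f'_bound by (metis vimage_eq)
qed

lemma ang_deriv_circ_pt: "ang_deriv u (circ_pt r \<theta>) = deriv (\<lambda>\<theta>. u (circ_pt r \<theta>)) \<theta>"
  using DERIV_shift[of "\<lambda>t. u (circ_pt r t)" _ 0 \<theta>]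
  by (simp add: ang_deriv_def deriv_def rot_circ_pt add.commute)

text \<open>Measurability comes from writing the derivative as a limit of difference quotients off the
  countable exceptional set.\<close>

lemma circ_integrable_ang_deriv:
  assumes v: "continuous_on (sphere 0 r) v" and r: "r > 0"
    and E: "countable E"
    and diff: "\<And>\<theta>. \<theta> \<notin> E \<Longrightarrow> \<exists>d. ((\<lambda>\<theta>. v (circ_pt r \<theta>)) has_real_derivative d) (at \<theta>) \<and> \<bar>d\<bar> \<le> B"
  shows "circ_integrable r (ang_deriv v)"
proof -
  let ?u = "\<lambda>\<theta>. v (circ_pt r \<theta>)"
  define D where "D \<theta> = indicator (- E) \<theta> * deriv ?u \<theta>" for \<theta>
  have "continuous_on UNIV ?u"
    using sphere_eq_circ_pt[OF r] by (intro continuous_on_compose2[OF v continuous_on_circ_pt]) auto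
  then have [measurable]: "?u \<in> borel_measurable borel"
    by (rule borel_measurable_continuous_onI)
  have [measurable]: "- E \<in> sets borel"
    using sets.countable[of E borel] E by (simp add: borel_comp)
  have deriv: "(?u has_real_derivative deriv ?u \<theta>) (at \<theta>)" "\<bar>deriv ?u \<theta>\<bar> \<le> B" if "\<theta> \<notin> E" for \<theta>
    using diff[OF that] DERIV_imp_deriv by (metis, metis)
  have "D \<in> borel_measurable borel"
  proof (rule borel_measurable_LIMSEQ_real)
    fix \<theta>
    show "(\<lambda>n. indicator (- E) \<theta> * ((?u (\<theta> + inverse (real (Suc n))) - ?u \<theta>) / inverse (real (Suc n))))
        \<longlonglongrightarrow> D \<theta>"
    proof (cases "\<theta> \<in> E")
      case False
      have "filterlim (\<lambda>n. inverse (real (Suc n))) (at 0) sequentially"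
        using LIMSEQ_inverse_real_of_nat by (auto simp: filterlim_at)
      then have "(\<lambda>n. (?u (\<theta> + inverse (real (Suc n))) - ?u \<theta>) / inverse (real (Suc n))) \<longlonglongrightarrow> deriv ?u \<theta>"
        using deriv(1)[OF False] unfolding DERIV_def by (rule filterlim_compose[rotated])
      then show ?thesis using False by (simp add: D_def)
    qed (simp add: D_def)
  qed measurable
  then have "D \<in> borel_measurable (lebesgue_on {0..2*pi})"
    by (simp add: measurable_completion measurable_restrict_space1)
  moreover have "\<bar>D \<theta>\<bar> \<le> \<bar>B\<bar>" for \<theta>
    using deriv(2)[of \<theta>] by (auto simp: D_def indicator_def)
  ultimately have "integrable (lebesgue_on {0..2*pi}) D"
    by (intro Bochner_Integration.integrable_bound[OF Lebesgue_Measure.integrable_const_ivl[of 0 "2 * pi" "\<bar>B\<bar>"]] AE_I2) simp_all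
  then have "D absolutely_integrable_on {0..2*pi}"
    by (simp add: set_integrable_def integrable_restrict_space)
  then have "(\<lambda>\<theta>. ang_deriv v (circ_pt r \<theta>)) absolutely_integrable_on {0..2*pi}"
    by (rule absolutely_integrable_spike[where S = E])
      (auto simp: D_def ang_deriv_circ_pt E negligible_iff_null_sets countable_imp_null_set_lborel null_sets_completionI)
  then show ?thesis
    unfolding circ_integrable_def by (intro absolutely_integrable_imp_integrable) auto
qed

lemma ang_deriv_sum:
  assumes "\<And>j. j \<in> J \<Longrightarrow> \<exists>d. ((\<lambda>\<theta>. w j (circ_pt r \<theta>)) has_real_derivative d) (at \<theta>)"
  shows "ang_deriv (\<lambda>x. \<Sum>j\<in>J. c j * w j x) (circ_pt r \<theta>) = (\<Sum>j\<in>J. c j * ang_deriv (w j) (circ_pt r \<theta>))"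
proof -
  have "((\<lambda>\<theta>. w j (circ_pt r \<theta>)) has_real_derivative ang_deriv (w j) (circ_pt r \<theta>)) (at \<theta>)" if "j \<in> J" for j
    using assms[OF that] DERIV_imp_deriv by (metis ang_deriv_circ_pt)
  then have "((\<lambda>\<theta>. \<Sum>j\<in>J. c j * w j (circ_pt r \<theta>)) has_real_derivative
      (\<Sum>j\<in>J. c j * ang_deriv (w j) (circ_pt r \<theta>))) (at \<theta>)"
    by (intro DERIV_sum DERIV_cmult)
  then show ?thesis
    unfolding ang_deriv_circ_pt by (rule DERIV_imp_deriv)
qed

section \<open>Smoothness of the torque\<close>

definition stiffness :: "(real^2) set \<Rightarrow> (real^2 \<Rightarrow> real) \<Rightarrow> (real^2 \<Rightarrow> real) \<Rightarrow> (real^2 \<Rightarrow> real) \<Rightarrow> real" where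
  "stiffness \<Omega> \<nu> v w = L2_inner \<Omega> (\<lambda>x. \<nu> x *\<^sub>R weak_grad \<Omega> v x) (weak_grad \<Omega> w)"

text \<open>This equivalence is used in both directions: at the solution it yields the equations for the
  coefficients, and at the solution plus an element of the kernel it yields a second solution of
  the mortar problem, which uniqueness excludes.\<close>

lemma mortar_solution_iff:
  fixes eS :: "'a \<Rightarrow> real^2 \<Rightarrow> real" and eR :: "'b \<Rightarrow> real^2 \<Rightarrow> real"
  assumes r: "r > 0"
    and \<Omega>S: "open \<Omega>S" "bounded \<Omega>S" and \<Omega>R: "open \<Omega>R" "bounded \<Omega>R"
    and \<nu>: "coefficient \<Omega>S \<nu>S" "coefficient \<Omega>R \<nu>R"
    and data: "je \<in> L2 \<Omega>S" "Mperp \<in> L2 \<Omega>R"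
    and VS: "spans IS eS VS" "VS \<subseteq> H1 \<Omega>S" "\<forall>v\<in>VS. circ_integrable r v"
    and VR: "spans IR eR VR" "VR \<subseteq> H1 \<Omega>R" "\<forall>v\<in>VR. circ_integrable r v"
    and \<Lambda>: "spans IL (trig_fn r) (trig_space r N)"
  shows "mortar_solution \<Omega>S \<Omega>R r \<nu>S \<nu>R je Mperp VS VR N \<alpha>
      (\<lambda>x. \<Sum>j\<in>IS. p j * eS j x, \<lambda>x. \<Sum>j\<in>IR. q j * eR j x, \<lambda>x. \<Sum>k\<in>IL. l k * trig_fn r k x) \<longleftrightarrow>
    (\<forall>i\<in>IS. (\<Sum>j\<in>IS. stiffness \<Omega>S \<nu>S (eS j) (eS i) * p j) + (\<Sum>k\<in>IL. circ_inner r (trig_fn r k) (eS i) * l k) = L2_inner \<Omega>S je (eS i)) \<and>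
    (\<forall>i\<in>IR. (\<Sum>j\<in>IR. stiffness \<Omega>R \<nu>R (eR j) (eR i) * q j) - (\<Sum>k\<in>IL. circ_inner r (trig_fn r k) (eR i \<circ> rot (- \<alpha>)) * l k) = - L2_inner \<Omega>R Mperp (weak_grad \<Omega>R (eR i))) \<and>
    (\<forall>m\<in>IL. (\<Sum>j\<in>IS. circ_inner r (trig_fn r m) (eS j) * p j) - (\<Sum>j\<in>IR. circ_inner r (trig_fn r m) (eR j \<circ> rot (- \<alpha>)) * q j) = 0)"
proof -
  define aS where "aS = (\<lambda>x. \<Sum>j\<in>IS. p j * eS j x)"
  define aR where "aR = (\<lambda>x. \<Sum>j\<in>IR. q j * eR j x)"
  define lam where "lam = (\<lambda>x. \<Sum>k\<in>IL. l k * trig_fn r k x)"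
  have fin: "finite IS" "finite IR" "finite IL"
    using VS(1) VR(1) \<Lambda> by (auto simp: spans_def)
  have eS: "eS i \<in> H1 \<Omega>S" "eS i \<in> L2 \<Omega>S" "circ_integrable r (eS i)" if "i \<in> IS" for i
    using spans_basis_mem[OF VS(1) that] VS(2,3) by (auto simp: H1_def has_weak_grad_def)
  have eR: "eR i \<in> H1 \<Omega>R" "circ_integrable r (eR i)" if "i \<in> IR" for i
    using spans_basis_mem[OF VR(1) that] VR(2,3) by auto
  have mem: "aS \<in> VS" "aR \<in> VR" "lam \<in> trig_space r N"
    unfolding aS_def aR_def lam_def using spans_mem VS(1) VR(1) \<Lambda> by blast+
  note rot_int = circ_integrable_rot[where t = "- \<alpha>"]
  define FS where "FS v = L2_inner \<Omega>S (\<lambda>x. \<nu>S x *\<^sub>R weak_grad \<Omega>S aS x) (weak_grad \<Omega>S v)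
    + circ_inner r lam v - L2_inner \<Omega>S je v" for v
  define FR where "FR v = L2_inner \<Omega>R (\<lambda>x. \<nu>R x *\<^sub>R weak_grad \<Omega>R aR x) (weak_grad \<Omega>R v)
    - circ_inner r lam (v \<circ> rot (- \<alpha>)) + L2_inner \<Omega>R Mperp (weak_grad \<Omega>R v)" for v
  define FL where "FL \<mu> = circ_inner r (\<lambda>x. aS x - (aR \<circ> rot (- \<alpha>)) x) \<mu>" for \<mu>
  have F_iff: "mortar_solution \<Omega>S \<Omega>R r \<nu>S \<nu>R je Mperp VS VR N \<alpha> (aS, aR, lam) \<longleftrightarrow>
      (\<forall>v\<in>VS. FS v = 0) \<and> (\<forall>v\<in>VR. FR v = 0) \<and> (\<forall>\<mu>\<in>trig_space r N. FL \<mu> = 0)"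
    unfolding mortar_solution_def FS_def FR_def FL_def using mem
    by (simp add: eq_neg_iff_add_eq_0)
  have aS: "aS \<in> H1 \<Omega>S" "circ_integrable r aS" and aR: "aR \<in> H1 \<Omega>R" "circ_integrable r aR"
    using mem VS(2,3) VR(2,3) by auto
  have "(\<forall>v\<in>VS. FS v = 0) \<longleftrightarrow> (\<forall>i\<in>IS. FS (eS i) = 0)"
  proof (rule spans_ball_iff[OF VS(1)])
    fix c
    have "L2_inner \<Omega>S (\<lambda>x. \<nu>S x *\<^sub>R weak_grad \<Omega>S aS x) (weak_grad \<Omega>S (\<lambda>x. \<Sum>i\<in>IS. c i * eS i x)) =
        (\<Sum>i\<in>IS. c i * L2_inner \<Omega>S (\<lambda>x. \<nu>S x *\<^sub>R weak_grad \<Omega>S aS x) (weak_grad \<Omega>S (eS i)))"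
      by (intro L2_inner_weak_grad_sum \<Omega>S fin eS L2_coefficient \<nu> weak_grad_L2 aS)
    moreover have "circ_inner r lam (\<lambda>x. \<Sum>i\<in>IS. c i * eS i x) = (\<Sum>i\<in>IS. c i * circ_inner r lam (eS i))"
      unfolding lam_def by (intro circ_inner_trig_sum_right r eS)
    moreover have "L2_inner \<Omega>S je (\<lambda>x. \<Sum>i\<in>IS. c i * eS i x) = (\<Sum>i\<in>IS. c i * L2_inner \<Omega>S je (eS i))"
      by (intro L2_inner_sum fin eS data)
    ultimately show "FS (\<lambda>x. \<Sum>i\<in>IS. c i * eS i x) = (\<Sum>i\<in>IS. c i * FS (eS i))"
      by (simp add: FS_def distrib_left right_diff_distrib sum.distrib sum_subtractf)
  qed
  moreover have "FS (eS i) = (\<Sum>j\<in>IS. stiffness \<Omega>S \<nu>S (eS j) (eS i) * p j) + (\<Sum>k\<in>IL. circ_inner r (trig_fn r k) (eS i) * l k) - L2_inner \<Omega>S je (eS i)"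
    if i: "i \<in> IS" for i
  proof -
    have "L2_inner \<Omega>S (\<lambda>x. \<nu>S x *\<^sub>R weak_grad \<Omega>S aS x) (weak_grad \<Omega>S (eS i)) = (\<Sum>j\<in>IS. p j * stiffness \<Omega>S \<nu>S (eS j) (eS i))"
      unfolding aS_def stiffness_def by (intro stiffness_sum \<Omega>S fin eS \<nu> i)
    then show ?thesis
      unfolding FS_def lam_def circ_inner_sum_left[OF r eS(3)[OF i]] by (simp add: mult.commute)
  qed
  moreover have "(\<forall>v\<in>VR. FR v = 0) \<longleftrightarrow> (\<forall>i\<in>IR. FR (eR i) = 0)"
  proof (rule spans_ball_iff[OF VR(1)])
    fix c
    have "L2_inner \<Omega>R (\<lambda>x. \<nu>R x *\<^sub>R weak_grad \<Omega>R aR x) (weak_grad \<Omega>R (\<lambda>x. \<Sum>i\<in>IR. c i * eR i x)) =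
        (\<Sum>i\<in>IR. c i * L2_inner \<Omega>R (\<lambda>x. \<nu>R x *\<^sub>R weak_grad \<Omega>R aR x) (weak_grad \<Omega>R (eR i)))"
      by (intro L2_inner_weak_grad_sum \<Omega>R fin eR L2_coefficient \<nu> weak_grad_L2 aR)
    moreover have "circ_inner r lam ((\<lambda>x. \<Sum>i\<in>IR. c i * eR i x) \<circ> rot (- \<alpha>)) =
        (\<Sum>i\<in>IR. c i * circ_inner r lam (eR i \<circ> rot (- \<alpha>)))"
      unfolding lam_def sum_rot by (intro circ_inner_trig_sum_right r rot_int eR)
    moreover have "L2_inner \<Omega>R Mperp (weak_grad \<Omega>R (\<lambda>x. \<Sum>i\<in>IR. c i * eR i x)) =
        (\<Sum>i\<in>IR. c i * L2_inner \<Omega>R Mperp (weak_grad \<Omega>R (eR i)))"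
      by (intro L2_inner_weak_grad_sum \<Omega>R fin eR data)
    ultimately show "FR (\<lambda>x. \<Sum>i\<in>IR. c i * eR i x) = (\<Sum>i\<in>IR. c i * FR (eR i))"
      by (simp add: FR_def distrib_left right_diff_distrib sum.distrib sum_subtractf)
  qed
  moreover have "FR (eR i) = (\<Sum>j\<in>IR. stiffness \<Omega>R \<nu>R (eR j) (eR i) * q j) - (\<Sum>k\<in>IL. circ_inner r (trig_fn r k) (eR i \<circ> rot (- \<alpha>)) * l k)
      + L2_inner \<Omega>R Mperp (weak_grad \<Omega>R (eR i))" if i: "i \<in> IR" for i
  proof -
    have "L2_inner \<Omega>R (\<lambda>x. \<nu>R x *\<^sub>R weak_grad \<Omega>R aR x) (weak_grad \<Omega>R (eR i)) = (\<Sum>j\<in>IR. q j * stiffness \<Omega>R \<nu>R (eR j) (eR i))"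
      unfolding aR_def stiffness_def by (intro stiffness_sum \<Omega>R fin eR \<nu> i)
    then show ?thesis
      unfolding FR_def lam_def circ_inner_sum_left[OF r rot_int[OF eR(2)[OF i]]]
      by (simp add: mult.commute)
  qed
  moreover have "(\<forall>\<mu>\<in>trig_space r N. FL \<mu> = 0) \<longleftrightarrow> (\<forall>k\<in>IL. FL (trig_fn r k) = 0)"
  proof (rule spans_ball_iff[OF \<Lambda>])
    show "FL (\<lambda>x. \<Sum>k\<in>IL. c k * trig_fn r k x) = (\<Sum>k\<in>IL. c k * FL (trig_fn r k))" for c
      unfolding FL_def circ_inner_commute[of r "\<lambda>x. aS x - (aR \<circ> rot (- \<alpha>)) x"]
      by (intro circ_inner_sum_left r circ_integrable_diff aS rot_int aR)
  qed
  moreover have "FL (trig_fn r m) = (\<Sum>j\<in>IS. circ_inner r (trig_fn r m) (eS j) * p j) - (\<Sum>j\<in>IR. circ_inner r (trig_fn r m) (eR j \<circ> rot (- \<alpha>)) * q j)" for m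
  proof -
    have "FL (trig_fn r m) = circ_inner r (trig_fn r m) aS - circ_inner r (trig_fn r m) (aR \<circ> rot (- \<alpha>))"
      unfolding FL_def circ_inner_commute[of r "\<lambda>x. aS x - (aR \<circ> rot (- \<alpha>)) x"]
      by (intro circ_inner_trig_diff r aS rot_int aR)
    also have "circ_inner r (trig_fn r m) aS = (\<Sum>j\<in>IS. circ_inner r (trig_fn r m) (eS j) * p j)"
      unfolding aS_def by (subst circ_inner_sum_right[OF r eS(3)]) (simp_all add: mult.commute)
    also have "circ_inner r (trig_fn r m) (aR \<circ> rot (- \<alpha>)) = (\<Sum>j\<in>IR. circ_inner r (trig_fn r m) (eR j \<circ> rot (- \<alpha>)) * q j)"
      unfolding aR_def sum_rot
      by (subst circ_inner_sum_right[OF r rot_int[OF eR(2)]]) (simp_all add: mult.commute)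
    finally show ?thesis .
  qed
  ultimately show ?thesis
    unfolding F_iff[unfolded aS_def aR_def lam_def] by (simp add: eq_neg_iff_add_eq_0)
qed

theorem mainTheorem3:
  fixes \<Omega>S \<Omega>R :: "(real^2) set" and r :: real
    and \<nu>S \<nu>R je :: "real^2 \<Rightarrow> real" and Mperp :: "real^2 \<Rightarrow> real^2"
    and \<T>S \<T>R :: "(real^2) set set" and VS VR :: "(real^2 \<Rightarrow> real) set" and N :: nat
  assumes "r > 0"
    and "lipschitz_domain \<Omega>S" "bounded \<Omega>S"
    and "lipschitz_domain \<Omega>R" "bounded \<Omega>R"
    and "\<Omega>R \<subseteq> inside \<Omega>S"
    and "frontier \<Omega>S \<inter> frontier \<Omega>R = sphere 0 r" "frontier \<Omega>R = sphere 0 r"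
    and "coefficient \<Omega>S \<nu>S" "coefficient \<Omega>R \<nu>R"
    and "je \<in> L2 \<Omega>S" "Mperp \<in> L2 \<Omega>R"
    and "mesh \<Omega>S \<T>S" "fe_space \<Omega>S \<T>S VS"
    and "\<forall>v\<in>VS. \<forall>x\<in>frontier \<Omega>S - sphere 0 r. v x = 0"
    and "mesh \<Omega>R \<T>R" "fe_space \<Omega>R \<T>R VR"
    and "\<forall>\<alpha>. \<exists>!s. mortar_solution \<Omega>S \<Omega>R r \<nu>S \<nu>R je Mperp VS VR N \<alpha> s"
  shows "infinitely_differentiable
    (\<lambda>\<alpha>. torque r \<alpha> (THE s. mortar_solution \<Omega>S \<Omega>R r \<nu>S \<nu>R je Mperp VS VR N \<alpha> s))"
proof -
  let ?M = "mortar_solution \<Omega>S \<Omega>R r \<nu>S \<nu>R je Mperp VS VR N"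
  note r = \<open>r > 0\<close>
  have \<Omega>S: "open \<Omega>S" "bounded \<Omega>S" and \<Omega>R: "open \<Omega>R" "bounded \<Omega>R"
    using assms(2-5) by (auto simp: lipschitz_domain_def)
  have circle: "sphere 0 r \<subseteq> closure \<Omega>S" "sphere 0 r \<subseteq> closure \<Omega>R"
    using assms(7,8) by (auto simp: frontier_def)
  have VS_circ: "circ_integrable r v" if "v \<in> VS" for v
    using that assms(14) circle(1) r
    by (intro circ_integrable_continuous) (auto simp: fe_space_def intro: continuous_on_subset)
  have VR_cont: "continuous_on (sphere 0 r) v" if "v \<in> VR" for v
    using that assms(17) circle(2) by (auto simp: fe_space_def intro: continuous_on_subset)
  then have VR_circ: "circ_integrable r v" if "v \<in> VR" for v
    using that r by (intro circ_integrable_continuous)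
  have VR_diff: "\<exists>E B. countable E \<and> (\<forall>\<theta>. \<theta> \<notin> E \<longrightarrow>
      (\<exists>d. ((\<lambda>\<theta>. v (circ_pt r \<theta>)) has_real_derivative d) (at \<theta>) \<and> \<bar>d\<bar> \<le> B))" if "v \<in> VR" for v
  proof -
    have "finite \<T>R" "\<And>K. K \<in> \<T>R \<Longrightarrow> compact K" "sphere 0 r \<subseteq> \<Union>\<T>R" "piecewise_smooth \<T>R v"
      using that assms(16,17) circle(2) by (auto simp: mesh_def fe_space_def)
    from piecewise_smooth_circle[OF this(1-3) r this(4)] show ?thesis by metis
  qed
  have VR_ang: "circ_integrable r (ang_deriv v)" if "v \<in> VR" for v
    using VR_diff[OF that] circ_integrable_ang_deriv[OF VR_cont[OF that] r] by metis
  have H1: "VS \<subseteq> H1 \<Omega>S" "VR \<subseteq> H1 \<Omega>R"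
    using assms(14,17) by (auto simp: fe_space_def)
  obtain IS where IS: "spans IS (\<lambda>b. b) VS" "lin_indep IS (\<lambda>b. b)"
    using assms(14) spans_finite_dim_space ex_basis unfolding fe_space_def by metis
  obtain IR where IR: "spans IR (\<lambda>b. b) VR" "lin_indep IR (\<lambda>b. b)"
    using assms(17) spans_finite_dim_space ex_basis unfolding fe_space_def by metis
  obtain IL where IL: "spans IL (trig_fn r) (trig_space r N)" "lin_indep IL (trig_fn r)"
    using ex_basis[OF spans_trig_space[OF r]] by metis
  let ?KS = "stiffness \<Omega>S \<nu>S" and ?KR = "stiffness \<Omega>R \<nu>R"
    and ?C = "\<lambda>k v. circ_inner r (trig_fn r k) v"
    and ?E = "\<lambda>k v \<alpha>. circ_inner r (trig_fn r k) (v \<circ> rot (- \<alpha>))"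
  have circ_int: "\<forall>v\<in>VS. circ_integrable r v" "\<forall>v\<in>VR. circ_integrable r v"
    using VS_circ VR_circ by blast+
  note sol_iff = mortar_solution_iff[OF r \<Omega>S \<Omega>R assms(9-12) IS(1) H1(1) circ_int(1)
      IR(1) H1(2) circ_int(2) IL(1)]
  define sol where "sol \<alpha> = (THE s. ?M \<alpha> s)" for \<alpha>
  have sol: "?M \<alpha> (sol \<alpha>)" and sol_unique: "?M \<alpha> s \<Longrightarrow> s = sol \<alpha>" for \<alpha> s
    using assms(18) theI'[of "?M \<alpha>"] unfolding sol_def by (auto intro: the1_equality[symmetric])
  define comb where "comb = (\<lambda>(p, q, l). (\<lambda>x. \<Sum>b\<in>IS. p b * b x, \<lambda>x. \<Sum>b\<in>IR. q b * b x,
    \<lambda>x. \<Sum>k\<in>IL. l k * trig_fn r k x))"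
  have "\<exists>c. sol \<alpha> = comb c" for \<alpha>
  proof -
    obtain aS aR lam where s: "sol \<alpha> = (aS, aR, lam)" by (cases "sol \<alpha>")
    then have "aS \<in> VS" "aR \<in> VR" "lam \<in> trig_space r N"
      using sol[of \<alpha>] by (auto simp: mortar_solution_def)
    then obtain p q l where "aS = (\<lambda>x. \<Sum>b\<in>IS. p b * b x)" "aR = (\<lambda>x. \<Sum>b\<in>IR. q b * b x)"
      "lam = (\<lambda>x. \<Sum>k\<in>IL. l k * trig_fn r k x)"
      using IS(1) IR(1) IL(1) unfolding spans_def by blast
    then have "sol \<alpha> = comb (p, q, l)" by (simp add: s comb_def)
    then show ?thesis by blast
  qed
  then obtain c where c: "\<And>\<alpha>. sol \<alpha> = comb (c \<alpha>)" by metis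
  define p q l where "p b \<alpha> = fst (c \<alpha>) b" and "q b \<alpha> = fst (snd (c \<alpha>)) b"
    and "l k \<alpha> = snd (snd (c \<alpha>)) k" for b k \<alpha>
  have sol_eq: "sol \<alpha> = (\<lambda>x. \<Sum>b\<in>IS. p b \<alpha> * b x, \<lambda>x. \<Sum>b\<in>IR. q b \<alpha> * b x,
      \<lambda>x. \<Sum>k\<in>IL. l k \<alpha> * trig_fn r k x)" for \<alpha>
    by (simp add: c comb_def p_def q_def l_def case_prod_unfold)
  have eqs: "(\<forall>i\<in>IS. (\<Sum>j\<in>IS. ?KS j i * p j \<alpha>) + (\<Sum>k\<in>IL. ?C k i * l k \<alpha>) = L2_inner \<Omega>S je i) \<and>
    (\<forall>i\<in>IR. (\<Sum>j\<in>IR. ?KR j i * q j \<alpha>) - (\<Sum>k\<in>IL. ?E k i \<alpha> * l k \<alpha>) = - L2_inner \<Omega>R Mperp (weak_grad \<Omega>R i)) \<and>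
    (\<forall>m\<in>IL. (\<Sum>j\<in>IS. ?C m j * p j \<alpha>) - (\<Sum>j\<in>IR. ?E m j \<alpha> * q j \<alpha>) = 0)" for \<alpha>
    using sol[of \<alpha>] unfolding sol_eq sol_iff .
  have E_smooth: "infinitely_differentiable (?E k v)" if "k \<in> IL" "v \<in> IR" for k v
    using VR_circ spans_basis_mem[OF IR(1) that(2)] by (intro smooth_circ_inner_rot r) auto
  have ker: "(\<forall>i\<in>IS. p' i = 0) \<and> (\<forall>i\<in>IR. q' i = 0) \<and> (\<forall>k\<in>IL. l' k = 0)"
    if hom: "\<And>i. i \<in> IS \<Longrightarrow> (\<Sum>j\<in>IS. ?KS j i * p' j) + (\<Sum>k\<in>IL. ?C k i * l' k) = 0"
      "\<And>i. i \<in> IR \<Longrightarrow> (\<Sum>j\<in>IR. ?KR j i * q' j) - (\<Sum>k\<in>IL. ?E k i \<alpha> * l' k) = 0"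
      "\<And>m. m \<in> IL \<Longrightarrow> (\<Sum>j\<in>IS. ?C m j * p' j) - (\<Sum>j\<in>IR. ?E m j \<alpha> * q' j) = 0" for \<alpha> p' q' l'
  proof -
    have add: "(a + a') + (b + b') = c" if "a + b = c" "a' + b' = 0" for a a' b b' c :: real
      using that by simp
    have diff: "(a + a') - (b + b') = c" if "a - b = c" "a' - b' = 0" for a a' b b' c :: real
      using that by simp
    have "?M \<alpha> (\<lambda>x. \<Sum>b\<in>IS. (p b \<alpha> + p' b) * b x, \<lambda>x. \<Sum>b\<in>IR. (q b \<alpha> + q' b) * b x,
        \<lambda>x. \<Sum>k\<in>IL. (l k \<alpha> + l' k) * trig_fn r k x)"
      unfolding sol_iff distrib_left sum.distrib
      by (intro conjI ballI add diff hom) (use eqs[of \<alpha>] in blast)+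
    note sol_unique[OF this, unfolded sol_eq]
    then have "(\<Sum>b\<in>IS. p' b * b x) = 0" "(\<Sum>b\<in>IR. q' b * b x) = 0" "(\<Sum>k\<in>IL. l' k * trig_fn r k x) = 0" for x
      by (simp_all add: distrib_right sum.distrib fun_eq_iff)
    then show ?thesis
      using IS(2) IR(2) IL(2) unfolding lin_indep_def by blast
  qed
  have fin: "finite IS" "finite IR" "finite IL"
    using IS(1) IR(1) IL(1) by (auto simp: spans_def)
  have eq1: "i \<in> IS \<Longrightarrow> (\<Sum>j\<in>IS. ?KS j i * p j \<alpha>) + (\<Sum>k\<in>IL. ?C k i * l k \<alpha>) = L2_inner \<Omega>S je i"
    and eq2: "i \<in> IR \<Longrightarrow> (\<Sum>j\<in>IR. ?KR j i * q j \<alpha>) - (\<Sum>k\<in>IL. ?E k i \<alpha> * l k \<alpha>)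
      = - L2_inner \<Omega>R Mperp (weak_grad \<Omega>R i)"
    and eq3: "m \<in> IL \<Longrightarrow> (\<Sum>j\<in>IS. ?C m j * p j \<alpha>) - (\<Sum>j\<in>IR. ?E m j \<alpha> * q j \<alpha>) = 0" for \<alpha> i m
    using eqs[of \<alpha>] by blast+
  note smooth = saddle_point_coefficients_smooth[where IS = IS and IR = IR and IL = IL and KS = ?KS
      and KR = ?KR and C = ?C and E = ?E and p = p and q = q and l = l
      and fS = "L2_inner \<Omega>S je" and fR = "\<lambda>i. - L2_inner \<Omega>R Mperp (weak_grad \<Omega>R i)"]
  have smooth_q: "infinitely_differentiable (q b)" if "b \<in> IR" for b
    by (rule smooth(1)) (fact fin E_smooth eq1 eq2 eq3 ker that)+
  have smooth_l: "infinitely_differentiable (l k)" if "k \<in> IL" for k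
    by (rule smooth(2)) (fact fin E_smooth eq1 eq2 eq3 ker that)+
  define T where "T k v \<alpha> = circ_inner r (trig_fn r k) (ang_deriv v \<circ> rot (- \<alpha>))" for k v \<alpha>
  have T_smooth: "infinitely_differentiable (T k v)" if "v \<in> IR" for k v
    unfolding T_def using VR_ang spans_basis_mem[OF IR(1) that] by (intro smooth_circ_inner_rot r) auto
  have "torque r \<alpha> (sol \<alpha>) = (\<Sum>k\<in>IL. l k \<alpha> * (\<Sum>b\<in>IR. q b \<alpha> * T k b \<alpha>))" for \<alpha>
  proof -
    let ?aR = "\<lambda>x. \<Sum>b\<in>IR. q b \<alpha> * b x" and ?D = "\<lambda>x. \<Sum>b\<in>IR. q b \<alpha> * ang_deriv b x"
    have IR_ang: "circ_integrable r (ang_deriv b)" if "b \<in> IR" for b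
      using VR_ang spans_basis_mem[OF IR(1) that] by blast
    have "\<forall>b\<in>IR. \<exists>A. countable A \<and> (\<forall>\<theta>. \<theta> \<notin> A \<longrightarrow>
        (\<exists>d. ((\<lambda>\<theta>. b (circ_pt r \<theta>)) has_real_derivative d) (at \<theta>)))"
      using VR_diff spans_basis_mem[OF IR(1)] by metis
    from bchoice[OF this] obtain A where A: "\<forall>b\<in>IR. countable (A b) \<and> (\<forall>\<theta>. \<theta> \<notin> A b \<longrightarrow>
        (\<exists>d. ((\<lambda>\<theta>. b (circ_pt r \<theta>)) has_real_derivative d) (at \<theta>)))"
      by (rule exE)
    have int: "circ_integrable r (ang_deriv ?aR)"
      by (intro VR_ang spans_mem[OF IR(1)])
    have "torque r \<alpha> (sol \<alpha>) = (\<Sum>k\<in>IL. l k \<alpha> * circ_inner r (trig_fn r k) (ang_deriv ?aR \<circ> rot (- \<alpha>)))"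
      unfolding sol_eq torque_def by (simp add: circ_inner_sum_left r circ_integrable_rot int)
    also have "\<dots> = (\<Sum>k\<in>IL. l k \<alpha> * circ_inner r (trig_fn r k) (?D \<circ> rot (- \<alpha>)))"
    proof -
      have "circ_inner r (trig_fn r k) (ang_deriv ?aR \<circ> rot (- \<alpha>)) = circ_inner r (trig_fn r k) (?D \<circ> rot (- \<alpha>))" for k
      proof (rule circ_inner_cong_countable[OF r int circ_integrable_sum[OF IR_ang]])
        show "countable (\<Union>b\<in>IR. A b)"
          using A by (intro countable_UN countable_finite[OF fin(2)]) blast
        show "ang_deriv ?aR (circ_pt r \<theta>) = ?D (circ_pt r \<theta>)" if "\<theta> \<notin> (\<Union>b\<in>IR. A b)" for \<theta>
          using A that by (intro ang_deriv_sum) blast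
      qed
      then show ?thesis by simp
    qed
    also have "\<dots> = (\<Sum>k\<in>IL. l k \<alpha> * (\<Sum>b\<in>IR. q b \<alpha> * T k b \<alpha>))"
      unfolding sum_rot T_def
      by (intro sum.cong refl arg_cong[where f = "(*) _"] circ_inner_sum_right r circ_integrable_rot IR_ang)
    finally show ?thesis .
  qed
  then show ?thesis
    unfolding sol_def[symmetric] using smooth_q smooth_l T_smooth by (auto intro!: smooth_intros)
qed

end
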